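(* Let $K$ be a complete non-Archimedean field, $r\ge0$, and let $w_{\mathrm{univ}}$ be the universal realizable valuated matroid on the ground set $E=(K^{r+1})^*$. Then $$\overline{\mathcal X}_r(K)=\operatorname{Trop}(w_{\mathrm{univ}}),$$ that is, the map $x\mapsto[-\log\|f\|_x]_{f\in E}$ identifies the topological space $\overline{\mathcal X}_r(K)$ with the tropical linear space $\operatorname{Trop}(w_{\mathrm{univ}})\subseteq\mathbb T\mathbb P^E$ associated to $w_{\mathrm{univ}}$.
   Context: $K$ is a field complete with respect to a non-Archimedean absolute value $|\cdot|$ (possibly trivial), $\mathrm{val}=-\log|\cdot|$, $\overline{\mathbb R}=\mathbb R\cup\{\infty\}$. A seminorm on a finite-dimensional $K$-vector space $W$ is a map $\|\cdot\|\colon W\to\mathbb R$ with $\|w\|\ge0$, $\|\lambda w\|=|\lambda|\,\|w\|$, $\|w+w'\|\le\max\{\|w\|,\|w'\|\}$. $\overline{\mathcal X}_r(K)$ (the Goldman–Iwahori space) is the set of seminorms on $(K^{r+1})^*$ that are not identically zero, modulo homothety ($\|\cdot\|\sim c\|\cdot\|$, $c>0$), with the quotient of the topology of pointwise convergence; $\|\cdot\|_x$ denotes a representative of $x$. Valuated matroid of rank $\rho$ on a (possibly infinite) set $E$: a function $v\colon\binom E\rho\to\overline{\mathbb R}$ on the $\rho$-element subsets of $E$, not identically $\infty$, such that for all $A,B\in\binom E\rho$ and $a\in A\setminus B$ one has $v(A)+v(B)\ge\min_{b\in B}\{v(b\cup A\setminus a)+v(a\cup B\setminus b)\}$. Bases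 are the $A$ with $v(A)<\infty$. The universal realizable valuated matroid $w_{\mathrm{univ}}\colon\binom{(K^{r+1})^*}{r+1}\to\overline{\mathbb R}$, of rank $r+1$, is $\{f_0,\dots,f_r\}\mapsto\mathrm{val}(\det[f_0\cdots f_r])$ (in standard coordinates). For a set $E$ put $\mathbb T\mathbb P^E=(\overline{\mathbb R}^E\setminus\{(\infty)_{e\in E}\})/\mathbb R\cdot\mathbf 1$, with $\mathbf 1$ the all-one vector. For a valuated matroid $v$ of rank $r+1$ on $E$, the associated tropical linear space $\operatorname{Trop}(v)=\mathcal L(v)\subseteq\mathbb T\mathbb P^E$ is the set of $[u_e]_{e\in E}$ such that for every $\tau\in\binom E{r+2}$ the minimum $\min_{e\in\tau}\big(v(\tau\setminus\{e\})+u_e\big)$ is attained at least twice (a minimum equal to $\infty$ is attained by all terms). Topology: for finite $E'\subseteq E$ containing a basis, the restriction $v'=v|_{\binom{E'}{r+1}}$ is a valuated matroid and $\mathcal L(v')\subseteq\mathbb T\mathbb P^{E'}$ has the subspace topology (quotient topology on $\mathbb T\mathbb P^{E'}$); coordinate projections give $\mathcal L(v)=\varprojlim_{E'}\mathcal L(v')$, and $\mathcal L(v)$ is given the limit topology. *)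

theory Defs
  imports "HOL-Analysis.Analysis" "HOL-Library.Ramsey"
begin

section \<open>Complete non-Archimedean fields\<close>

definition nonarch_absolute_value :: "('k::field \<Rightarrow> real) \<Rightarrow> bool" where
  "nonarch_absolute_value absv \<longleftrightarrow>
     (\<forall>x. 0 \<le> absv x) \<and>
     (\<forall>x. absv x = 0 \<longleftrightarrow> x = 0) \<and>
     (\<forall>x y. absv (x * y) = absv x * absv y) \<and>
     (\<forall>x y. absv (x + y) \<le> max (absv x) (absv y))"

definition complete_nonarch_field :: "('k::field \<Rightarrow> real) \<Rightarrow> bool" where
  "complete_nonarch_field absv \<longleftrightarrow>
     nonarch_absolute_value absv \<and>
     Metric_space.mcomplete UNIV (\<lambda>x y. absv (x - y))"

text \<open>
  The extended line \<open>\<real> \<union> {\<infinity>}\<close> is the set \<open>{-\<infinity><..}\<close> of extended reals.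
\<close>

definition neg_log :: "real \<Rightarrow> ereal" where
  "neg_log t = (if t = 0 then \<infinity> else ereal (- ln t))"

definition val :: "('k::field \<Rightarrow> real) \<Rightarrow> 'k \<Rightarrow> ereal" where
  "val absv x = neg_log (absv x)"


section \<open>Quotient topologies\<close>

definition quotient_topology :: "'a topology \<Rightarrow> ('a \<times> 'a) set \<Rightarrow> 'a set topology" where
  "quotient_topology X R = topology (\<lambda>U. U \<subseteq> topspace X // R \<and> openin X (\<Union>U))"

lemma openin_quotient_topology:
  assumes "equiv (topspace X) R"
  shows "openin (quotient_topology X R) U \<longleftrightarrow> U \<subseteq> topspace X // R \<and> openin X (\<Union>U)"
proof -
  have "openin X (\<Union>(S \<inter> T))"
    if "S \<subseteq> topspace X // R" "T \<subseteq> topspace X // R" "openin X (\<Union>S)" "openin X (\<Union>T)" for S T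
  proof -
    have "\<Union>(S \<inter> T) = \<Union>S \<inter> \<Union>T"
    proof
      show "\<Union>S \<inter> \<Union>T \<subseteq> \<Union>(S \<inter> T)"
      proof
        fix x assume "x \<in> \<Union>S \<inter> \<Union>T"
        then obtain C D where "C \<in> S" "D \<in> T" "x \<in> C" "x \<in> D" by blast
        moreover from this that(1,2) have "C = D"
          using quotient_disj[OF assms, of C D] by blast
        ultimately show "x \<in> \<Union>(S \<inter> T)" by blast
      qed
    qed auto
    with that show ?thesis by auto
  qed
  moreover have "openin X (\<Union>(\<Union>K))" if "\<forall>S\<in>K. S \<subseteq> topspace X // R \<and> openin X (\<Union>S)" for K
  proof -
    have "\<Union>(\<Union>K) = \<Union>((\<Union>) ` K)" by auto
    with that show ?thesis by auto
  qed
  ultimately have "istopology (\<lambda>U. U \<subseteq> topspace X // R \<and> openin X (\<Union>U))"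
    unfolding istopology_def by blast
  then show ?thesis
    by (simp add: quotient_topology_def)
qed

lemma topspace_quotient_topology:
  assumes "equiv (topspace X) R"
  shows "topspace (quotient_topology X R) = topspace X // R"
proof -
  have "openin (quotient_topology X R) (topspace X // R)"
    by (simp add: openin_quotient_topology[OF assms] Union_quotient[OF assms])
  then show ?thesis
    by (metis assms openin_quotient_topology openin_subset openin_topspace subset_antisym)
qed

lemma quotient_map_quotient_topology:
  assumes "equiv (topspace X) R"
  shows "quotient_map X (quotient_topology X R) (\<lambda>x. R `` {x})"
proof -
  have "{x \<in> topspace X. R `` {x} \<in> U} = \<Union>U" if "U \<subseteq> topspace X // R" for U
  proof
    show "{x \<in> topspace X. R `` {x} \<in> U} \<subseteq> \<Union>U"
      using equiv_class_self[OF assms] by blast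
    show "\<Union>U \<subseteq> {x \<in> topspace X. R `` {x} \<in> U}"
    proof
      fix x assume "x \<in> \<Union>U"
      then obtain C where C: "C \<in> U" "x \<in> C" by auto
      with that have Cq: "C \<in> topspace X // R" by auto
      then have "x \<in> topspace X" using C assms in_quotient_imp_subset by blast
      moreover have "R `` {x} = C"
        using C Cq assms by (metis Image_singleton_iff equiv_class_eq quotientE)
      ultimately show "x \<in> {x \<in> topspace X. R `` {x} \<in> U}" using C by auto
    qed
  qed
  then show ?thesis
    by (auto simp: quotient_map_def topspace_quotient_topology[OF assms] openin_quotient_topology[OF assms]
        quotient_def)
qed


section \<open>The Goldman--Iwahori space\<close>

text \<open>
  \<open>K\<^sup>r\<^sup>+\<^sup>1\<close> is the type \<open>'k ^ 'n\<close> with \<open>CARD('n) = r + 1\<close>.  Functions on a set are taken to be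
  extensional, so that they are determined by their values on that set.
\<close>

definition dual :: "('k::field ^ 'n::finite \<Rightarrow> 'k) set" where
  "dual = {f. Vector_Spaces.linear (*s) (*) f}"

definition nonzero_seminorms ::
    "('k::field \<Rightarrow> real) \<Rightarrow> (('k ^ 'n::finite \<Rightarrow> 'k) \<Rightarrow> real) set" where
  "nonzero_seminorms absv =
     {N \<in> extensional dual.
        (\<forall>f\<in>dual. 0 \<le> N f) \<and>
        (\<forall>c. \<forall>f\<in>dual. N (\<lambda>x. c * f x) = absv c * N f) \<and>
        (\<forall>f\<in>dual. \<forall>g\<in>dual. N (\<lambda>x. f x + g x) \<le> max (N f) (N g)) \<and>
        (\<exists>f\<in>dual. N f \<noteq> 0)}"

definition homothety ::
    "('k::field \<Rightarrow> real) \<Rightarrow>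
      ((('k ^ 'n::finite \<Rightarrow> 'k) \<Rightarrow> real) \<times> (('k ^ 'n \<Rightarrow> 'k) \<Rightarrow> real)) set" where
  "homothety absv =
     {(N, N'). N \<in> nonzero_seminorms absv \<and> N' \<in> nonzero_seminorms absv \<and>
               (\<exists>c>0. \<forall>f\<in>dual. N' f = c * N f)}"

definition GI_topology ::
    "('k::field \<Rightarrow> real) \<Rightarrow> (('k ^ 'n::finite \<Rightarrow> 'k) \<Rightarrow> real) set topology" where
  "GI_topology absv =
     quotient_topology (subtopology (powertop_real dual) (nonzero_seminorms absv)) (homothety absv)"


section \<open>Valuated matroids\<close>

text \<open>
  Only the values of \<open>v\<close> on the \<open>\<rho>\<close>-element subsets of \<open>E\<close> matter, so the restriction of a
  valuated matroid to \<open>E' \<subseteq> E\<close> is the same function considered on \<open>E'\<close>.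
  In the exchange axiom \<open>b\<close> ranges over \<open>B - A\<close>: for \<open>b \<in> A \<inter> B\<close> the set
  \<open>insert b (A - {a})\<close> has fewer than \<open>\<rho>\<close> elements.
\<close>

definition valuated_matroid :: "'e set \<Rightarrow> nat \<Rightarrow> ('e set \<Rightarrow> ereal) \<Rightarrow> bool" where
  "valuated_matroid E \<rho> v \<longleftrightarrow>
     (\<forall>A\<in>nsets E \<rho>. v A \<noteq> -\<infinity>) \<and>
     (\<exists>A\<in>nsets E \<rho>. v A \<noteq> \<infinity>) \<and>
     (\<forall>A\<in>nsets E \<rho>. \<forall>B\<in>nsets E \<rho>. \<forall>a\<in>A - B.
        Min ((\<lambda>b. v (insert b (A - {a})) + v (insert a (B - {b}))) ` (B - A)) \<le> v A + v B)"

text \<open>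
  Another enumeration of \<open>A\<close> changes the determinant only by a sign; see \<open>w_univ_eq\<close>.
\<close>

definition w_univ :: "('k::field \<Rightarrow> real) \<Rightarrow> ('k ^ 'n::finite \<Rightarrow> 'k) set \<Rightarrow> ereal" where
  "w_univ absv A =
     (let h = SOME h :: 'n \<Rightarrow> 'k ^ 'n \<Rightarrow> 'k. bij_betw h UNIV A
      in val absv (det (\<chi> i j. h j (axis i 1))))"


section \<open>Tropical projective space and tropical linear spaces\<close>

definition TP_vectors :: "'e set \<Rightarrow> ('e \<Rightarrow> ereal) set" where
  "TP_vectors E = (E \<rightarrow>\<^sub>E {-\<infinity><..}) - {\<lambda>e\<in>E. \<infinity>}"

definition TP_rel :: "'e set \<Rightarrow> (('e \<Rightarrow> ereal) \<times> ('e \<Rightarrow> ereal)) set" where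
  "TP_rel E = {(u, w). u \<in> TP_vectors E \<and> w \<in> TP_vectors E \<and>
                       (\<exists>c::real. \<forall>e\<in>E. w e = u e + ereal c)}"

definition TP_class :: "'e set \<Rightarrow> ('e \<Rightarrow> ereal) \<Rightarrow> ('e \<Rightarrow> ereal) set" where
  "TP_class E u = TP_rel E `` {u}"

definition TP_topology :: "'e set \<Rightarrow> ('e \<Rightarrow> ereal) set topology" where
  "TP_topology E =
     quotient_topology (subtopology (product_topology (\<lambda>_. euclidean) E) (TP_vectors E)) (TP_rel E)"

definition Trop :: "'e set \<Rightarrow> nat \<Rightarrow> ('e set \<Rightarrow> ereal) \<Rightarrow> ('e \<Rightarrow> ereal) set set" where
  "Trop E \<rho> v =
     {TP_class E u | u. u \<in> TP_vectors E \<and>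
        (\<forall>\<tau>\<in>nsets E (\<rho> + 1).
           let t = (\<lambda>e. v (\<tau> - {e}) + u e)
           in \<exists>e1\<in>\<tau>. \<exists>e2\<in>\<tau>. e1 \<noteq> e2 \<and> t e1 = Min (t ` \<tau>) \<and> t e2 = Min (t ` \<tau>))}"

definition finite_restrictions :: "'e set \<Rightarrow> nat \<Rightarrow> ('e set \<Rightarrow> ereal) \<Rightarrow> 'e set set" where
  "finite_restrictions E \<rho> v = {E'. E' \<subseteq> E \<and> finite E' \<and> (\<exists>A\<in>nsets E' \<rho>. v A < \<infinity>)}"

text \<open>
  The class of \<open>u\<close> consists of all its translates by real constants, so its elementwise
  restriction to \<open>E'\<close> is the class of the restriction of \<open>u\<close>; see \<open>TP_proj_class\<close>.
\<close>

definition TP_proj :: "'e set \<Rightarrow> ('e \<Rightarrow> ereal) set \<Rightarrow> ('e \<Rightarrow> ereal) set" where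
  "TP_proj E' C = (\<lambda>u. restrict u E') ` C"

text \<open>
  The limit topology: the inverse limit is a subspace of the product of the spaces
  \<open>Trop E' \<rho> v\<close>, and its topology is transported to \<open>Trop E \<rho> v\<close> along the coordinate projections.
\<close>

definition Trop_topology :: "'e set \<Rightarrow> nat \<Rightarrow> ('e set \<Rightarrow> ereal) \<Rightarrow> ('e \<Rightarrow> ereal) set topology" where
  "Trop_topology E \<rho> v =
     pullback_topology (Trop E \<rho> v)
       (\<lambda>C. \<lambda>E'\<in>finite_restrictions E \<rho> v. TP_proj E' C)
       (product_topology (\<lambda>E'. subtopology (TP_topology E') (Trop E' \<rho> v))
          (finite_restrictions E \<rho> v))"


section \<open>Well-definedness\<close>

lemma equiv_homothety: "equiv (nonzero_seminorms absv) (homothety absv)"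
proof (rule equivI)
  show "homothety absv \<subseteq> nonzero_seminorms absv \<times> nonzero_seminorms absv"
    by (auto simp: homothety_def)
  show "refl_on (nonzero_seminorms absv) (homothety absv)"
    by (auto simp: refl_on_def homothety_def intro: exI[of _ 1])
  show "sym (homothety absv)"
  proof (rule symI)
    fix N N' assume "(N, N') \<in> homothety absv"
    then obtain c where c: "N \<in> nonzero_seminorms absv" "N' \<in> nonzero_seminorms absv"
        "c > 0" "\<forall>f\<in>dual. N' f = c * N f"
      by (auto simp: homothety_def)
    then have "\<forall>f\<in>dual. N f = inverse c * N' f" "inverse c > 0" by (auto simp: field_simps)
    with c show "(N', N) \<in> homothety absv" unfolding homothety_def by blast
  qed
  show "trans (homothety absv)"
  proof (rule transI)
    fix N1 N2 N3 assume a: "(N1, N2) \<in> homothety absv" "(N2, N3) \<in> homothety absv"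
    then obtain c d where "c > 0" "\<forall>f\<in>dual. N2 f = c * N1 f" "d > 0" "\<forall>f\<in>dual. N3 f = d * N2 f"
      by (auto simp: homothety_def)
    then have "\<forall>f\<in>dual. N3 f = (d * c) * N1 f" "d * c > 0" by auto
    with a show "(N1, N3) \<in> homothety absv" unfolding homothety_def by blast
  qed
qed

lemma topspace_seminorms:
  "topspace (subtopology (powertop_real dual) (nonzero_seminorms absv)) = nonzero_seminorms absv"
  by (auto simp: nonzero_seminorms_def PiE_def)

lemma topspace_GI_topology:
  "topspace (GI_topology absv) = nonzero_seminorms absv // homothety absv"
  by (metis GI_topology_def equiv_homothety topspace_quotient_topology topspace_seminorms)

lemma TP_vectors_iff:
  "u \<in> TP_vectors E \<longleftrightarrow> u \<in> extensional E \<and> (\<forall>e\<in>E. -\<infinity> < u e) \<and> (\<exists>e\<in>E. u e \<noteq> \<infinity>)"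
proof -
  have "u = (\<lambda>e\<in>E. \<infinity>) \<longleftrightarrow> (\<forall>e\<in>E. u e = \<infinity>)" if "u \<in> extensional E"
    using that by (auto intro: extensionalityI[where A = E])
  then show ?thesis
    by (auto simp: TP_vectors_def PiE_def Pi_def)
qed

lemma equiv_TP_rel: "equiv (TP_vectors E) (TP_rel E)"
proof (rule equivI)
  show "TP_rel E \<subseteq> TP_vectors E \<times> TP_vectors E"
    by (auto simp: TP_rel_def)
  show "refl_on (TP_vectors E) (TP_rel E)"
    by (auto simp: refl_on_def TP_rel_def intro: exI[of _ 0])
  show "sym (TP_rel E)"
  proof (rule symI)
    fix u w assume "(u, w) \<in> TP_rel E"
    then obtain c where c: "u \<in> TP_vectors E" "w \<in> TP_vectors E" "\<forall>e\<in>E. w e = u e + ereal c"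
      by (auto simp: TP_rel_def)
    have "u e = w e + ereal (- c)" if "e \<in> E" for e
      using c(3) that by (cases "u e") auto
    with c show "(w, u) \<in> TP_rel E" unfolding TP_rel_def by blast
  qed
  show "trans (TP_rel E)"
  proof (rule transI)
    fix u w x assume a: "(u, w) \<in> TP_rel E" "(w, x) \<in> TP_rel E"
    then obtain c d where "\<forall>e\<in>E. w e = u e + ereal c" "\<forall>e\<in>E. x e = w e + ereal d"
      unfolding TP_rel_def by blast
    then have "\<forall>e\<in>E. x e = u e + ereal (c + d)" by (auto simp: add.assoc)
    with a show "(u, x) \<in> TP_rel E" unfolding TP_rel_def by blast
  qed
qed

lemma topspace_TP_vectors:
  "topspace (subtopology (product_topology (\<lambda>_. euclidean) E) (TP_vectors E)) = TP_vectors E"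
  by (auto simp: TP_vectors_def PiE_def)

lemma topspace_TP_topology: "topspace (TP_topology E) = TP_vectors E // TP_rel E"
  by (metis TP_topology_def equiv_TP_rel topspace_quotient_topology topspace_TP_vectors)

lemma Trop_subset: "Trop E \<rho> v \<subseteq> TP_vectors E // TP_rel E"
  by (auto simp: Trop_def TP_class_def intro: quotientI)

lemma TP_class_eq:
  assumes "u \<in> TP_vectors E"
  shows "TP_class E u = range (\<lambda>c::real. \<lambda>e\<in>E. u e + ereal c)"
proof -
  have *: "(\<lambda>e\<in>E. u e + ereal c) \<in> TP_vectors E" for c :: real
  proof -
    from assms obtain e0 where "e0 \<in> E" "u e0 \<noteq> \<infinity>"
      unfolding TP_vectors_iff by blast
    then have "\<exists>e\<in>E. (\<lambda>e\<in>E. u e + ereal c) e \<noteq> \<infinity>" by (intro bexI[of _ e0]) auto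
    moreover have "-\<infinity> < u e + ereal c" if "e \<in> E" for e
    proof -
      have "-\<infinity> < u e" using assms that by (simp add: TP_vectors_iff)
      then show ?thesis by (cases "u e") auto
    qed
    ultimately show ?thesis by (simp add: TP_vectors_iff)
  qed
  show ?thesis
  proof
    show "TP_class E u \<subseteq> range (\<lambda>c::real. \<lambda>e\<in>E. u e + ereal c)"
    proof
      fix w assume "w \<in> TP_class E u"
      then obtain c where w: "w \<in> TP_vectors E" "\<forall>e\<in>E. w e = u e + ereal c"
        by (auto simp: TP_class_def TP_rel_def)
      then have "w \<in> extensional E" by (auto simp: TP_vectors_def PiE_def)
      then have "w = (\<lambda>e\<in>E. u e + ereal c)"
        using w by (auto simp: extensional_def fun_eq_iff)
      then show "w \<in> range (\<lambda>c::real. \<lambda>e\<in>E. u e + ereal c)" by blast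
    qed
    show "range (\<lambda>c::real. \<lambda>e\<in>E. u e + ereal c) \<subseteq> TP_class E u"
      using * assms by (auto simp: TP_class_def TP_rel_def)
  qed
qed

lemma TP_proj_class:
  assumes "u \<in> TP_vectors E" "E' \<subseteq> E" "restrict u E' \<in> TP_vectors E'"
  shows "TP_proj E' (TP_class E u) = TP_class E' (restrict u E')"
proof -
  have "restrict (\<lambda>e\<in>E. u e + ereal c) E' = (\<lambda>e\<in>E'. restrict u E' e + ereal c)" for c :: real
    using assms(2) by (auto simp: fun_eq_iff)
  then show ?thesis
    by (simp add: TP_proj_def TP_class_eq[OF assms(1)] TP_class_eq[OF assms(3)] image_image)
qed

lemma TP_proj_Trop:
  assumes nonneg: "\<forall>A\<in>nsets E \<rho>. v A \<noteq> -\<infinity>"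
    and C: "C \<in> Trop E \<rho> v" and E': "E' \<in> finite_restrictions E \<rho> v"
  shows "TP_proj E' C \<in> Trop E' \<rho> v"
proof -
  from E' obtain B where E'E: "E' \<subseteq> E" and B: "B \<subseteq> E'" "finite B" "card B = \<rho>" "v B < \<infinity>"
    by (auto simp: finite_restrictions_def nsets_def)
  from C obtain u where u: "u \<in> TP_vectors E" "C = TP_class E u"
    and min: "\<forall>\<tau>\<in>nsets E (\<rho> + 1).
        \<exists>e1\<in>\<tau>. \<exists>e2\<in>\<tau>. e1 \<noteq> e2 \<and> v (\<tau> - {e1}) + u e1 = Min ((\<lambda>e. v (\<tau> - {e}) + u e) ` \<tau>)
          \<and> v (\<tau> - {e2}) + u e2 = Min ((\<lambda>e. v (\<tau> - {e}) + u e) ` \<tau>)"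
    unfolding Trop_def Let_def by (elim CollectE exE conjE) (rule that; assumption)
  have upos: "-\<infinity> < u e" if "e \<in> E" for e
    using u that by (simp add: TP_vectors_iff)
  have "\<exists>e\<in>B. u e \<noteq> \<infinity>"
  proof (rule ccontr)
    assume "\<not> ?thesis"
    then have inf: "\<And>e. e \<in> B \<Longrightarrow> u e = \<infinity>" by auto
    from u obtain e0 where e0: "e0 \<in> E" "u e0 \<noteq> \<infinity>"
      unfolding TP_vectors_iff by blast
    then have "e0 \<notin> B" using inf by auto
    define \<tau> where "\<tau> = insert e0 B"
    have \<tau>: "\<tau> \<in> nsets E (\<rho> + 1)" "\<tau> - {e0} = B"
      using \<open>e0 \<notin> B\<close> B E'E e0 by (auto simp: \<tau>_def nsets_def)
    let ?t = "\<lambda>e. v (\<tau> - {e}) + u e"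
    have t0: "?t e0 < \<infinity>" using \<tau> B e0 by (cases "v B"; cases "u e0") auto
    have t1: "?t e = \<infinity>" if "e \<in> \<tau>" "e \<noteq> e0" for e
    proof -
      have "\<tau> - {e} \<in> nsets E \<rho>" using \<tau>(1) that by (auto simp: nsets_def)
      with nonneg have "v (\<tau> - {e}) \<noteq> -\<infinity>" by auto
      moreover have "u e = \<infinity>" using that inf by (auto simp: \<tau>_def)
      ultimately show ?thesis by auto
    qed
    have "finite \<tau>" "e0 \<in> \<tau>" using B by (auto simp: \<tau>_def)
    then have "Min (?t ` \<tau>) \<le> ?t e0" by auto
    with t0 have "Min (?t ` \<tau>) < \<infinity>" by (rule order.strict_trans1[rotated])
    with bspec[OF min \<tau>(1)] t1 show False by (metis less_irrefl)
  qed
  then obtain e0 where e0: "e0 \<in> B" "u e0 \<noteq> \<infinity>" by auto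
  then have "\<exists>e\<in>E'. restrict u E' e \<noteq> \<infinity>" using B by (intro bexI[of _ e0]) auto
  then have r: "restrict u E' \<in> TP_vectors E'"
    using upos E'E by (auto simp: TP_vectors_iff)
  have "\<exists>e1\<in>\<tau>. \<exists>e2\<in>\<tau>. e1 \<noteq> e2
      \<and> v (\<tau> - {e1}) + restrict u E' e1 = Min ((\<lambda>e. v (\<tau> - {e}) + restrict u E' e) ` \<tau>)
      \<and> v (\<tau> - {e2}) + restrict u E' e2 = Min ((\<lambda>e. v (\<tau> - {e}) + restrict u E' e) ` \<tau>)"
    if "\<tau> \<in> nsets E' (\<rho> + 1)" for \<tau>
  proof -
    have "\<tau> \<in> nsets E (\<rho> + 1)" "\<And>e. e \<in> \<tau> \<Longrightarrow> e \<in> E'"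
      using that E'E by (auto simp: nsets_def)
    moreover from this have "(\<lambda>e. v (\<tau> - {e}) + restrict u E' e) ` \<tau> = (\<lambda>e. v (\<tau> - {e}) + u e) ` \<tau>"
      by (intro image_cong) auto
    ultimately show ?thesis using bspec[OF min, of \<tau>] by simp
  qed
  then show ?thesis
    unfolding Trop_def Let_def u(2) TP_proj_class[OF u(1) E'E r]
    by (intro CollectI exI[of _ "restrict u E'"] conjI refl r ballI)
qed

lemma topspace_Trop_topology:
  assumes "\<forall>A\<in>nsets E \<rho>. v A \<noteq> -\<infinity>"
  shows "topspace (Trop_topology E \<rho> v) = Trop E \<rho> v"
proof -
  have "Trop E' \<rho> v \<inter> topspace (TP_topology E') = Trop E' \<rho> v" for E'
    using Trop_subset topspace_TP_topology by fast
  then show ?thesis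
    using TP_proj_Trop[OF assms]
    by (auto simp: Trop_topology_def topspace_pullback_topology Int_commute)
qed


section \<open>The universal realizable valuated matroid is a valuated matroid\<close>

lemma nonarch_absv_simps:
  assumes "nonarch_absolute_value absv"
  shows "absv 1 = 1" "absv (- x) = absv x"
proof -
  have m: "\<And>x y. absv (x * y) = absv x * absv y" and z: "\<And>x. absv x = 0 \<longleftrightarrow> x = 0"
    and p: "\<And>x. absv x \<ge> 0"
    using assms by (auto simp: nonarch_absolute_value_def)
  show 1: "absv 1 = 1" using m[of 1 1] z[of 1] by auto
  have "absv (-1) * absv (-1) = 1" using m[of "-1" "-1"] 1 by simp
  then have "absv (-1) = 1" using p[of "-1"] by (simp add: square_eq_1_iff)
  then show "absv (- x) = absv x" using m[of "-1" x] by simp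
qed

lemma w_univ_eq:
  fixes absv :: "'k::field \<Rightarrow> real" and h :: "'n::finite \<Rightarrow> 'k ^ 'n \<Rightarrow> 'k"
  assumes "nonarch_absolute_value absv" "bij_betw h UNIV A"
  shows "w_univ absv A = val absv (det (\<chi> i j. h j (axis i 1)))"
proof -
  define g where "g = (SOME h :: 'n \<Rightarrow> 'k ^ 'n \<Rightarrow> 'k. bij_betw h UNIV A)"
  have g: "bij_betw g UNIV A"
    unfolding g_def using assms(2) by (rule someI[where P = "\<lambda>h. bij_betw h UNIV A"])
  define p where "p = inv_into UNIV h \<circ> g"
  have "bij_betw p UNIV UNIV"
    unfolding p_def using g bij_betw_inv_into[OF assms(2)] by (rule bij_betw_trans)
  then have p: "p permutes UNIV" by (rule bij_imp_permutes) simp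
  have hp: "h (p j) = g j" for j
    unfolding p_def using g assms(2) by (auto simp: bij_betw_def intro!: f_inv_into_f)
  let ?M = "(\<chi> i j. h j (axis i 1)) :: 'k^'n^'n"
  have "det (\<chi> i j. g j (axis i 1)) = of_int (sign p) * det ?M"
    using det_permute_columns[OF p, of ?M] by (simp add: hp)
  then have "absv (det (\<chi> i j. g j (axis i 1))) = absv (det ?M)"
    by (cases "sign p = 1") (auto simp: sign_def nonarch_absv_simps[OF assms(1)])
  then show ?thesis by (simp add: w_univ_def Let_def g_def val_def)
qed

lemma nonarch_sum_le:
  assumes "nonarch_absolute_value absv" "finite I" "I \<noteq> {}"
  shows "\<exists>i\<in>I. absv (sum f I) \<le> absv (f i)"
  using assms(2,3)
proof (induction rule: finite_ne_induct)
  case (insert x F)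
  then obtain i where i: "i \<in> F" "absv (sum f F) \<le> absv (f i)" by auto
  have "absv (f x + sum f F) \<le> max (absv (f x)) (absv (sum f F))"
    using assms(1) by (auto simp: nonarch_absolute_value_def)
  with i insert show ?case by (auto simp: max_def split: if_splits intro: order_trans)
qed simp

lemma det_linear_column_sum:
  fixes M :: "'k::field ^ 'n ^ 'n"
  shows "det (\<chi> i j. if j = k then (\<Sum>l\<in>UNIV. x l * c l i) else M $ i $ j)
       = (\<Sum>l\<in>(UNIV::'n set). x l * det (\<chi> i j. if j = k then c l i else M $ i $ j))"
proof -
  have a: "(\<chi> i j. if j = k then a i else M $ i $ j) =
      transpose (\<chi> i. if i = k then (\<chi> j. a j) else row i (transpose M))" for a :: "'n \<Rightarrow> 'k"
    by (auto simp: vec_eq_iff transpose_def row_def)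
  have s: "(\<chi> j. \<Sum>l\<in>UNIV. x l * c l j) = (\<Sum>l\<in>UNIV. x l *s (\<chi> j. c l j))"
    by (auto simp: vec_eq_iff)
  show ?thesis
    unfolding a det_transpose s
    by (subst det_linear_row_sum) (simp_all add: det_row_mul)
qed

lemma det_repeated_column:
  fixes h :: "'n::finite \<Rightarrow> 'n \<Rightarrow> 'k::field"
  assumes "i \<noteq> j" "h i = h j"
  shows "det (\<chi> a b. h b a) = 0"
  by (rule det_identical_columns[OF assms(1)]) (simp add: column_def assms(2))

lemma bij_betw_replace:
  assumes "bij_betw g UNIV A" "g k = a" "b \<notin> A"
  shows "bij_betw (g(k := b)) UNIV (insert b (A - {a}))"
proof -
  have g: "inj g" "range g = A" using assms(1) by (auto simp: bij_betw_def)
  have "inj (g(k := b))"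
    using g assms(3) by (auto simp: inj_on_def)
  moreover have "range (g(k := b)) = insert b (g ` (UNIV - {k}))" by auto
  moreover have "g ` (UNIV - {k}) = A - {a}"
    using inj_on_image_set_diff[OF g(1), of UNIV "{k}"] g assms(2) by auto
  ultimately show ?thesis by (simp add: bij_betw_def)
qed

theorem valuated_matroid_w_univ:
  fixes absv :: "'k::field \<Rightarrow> real"
  assumes "nonarch_absolute_value absv"
  shows "valuated_matroid (dual :: ('k ^ 'n::finite \<Rightarrow> 'k) set) CARD('n) (w_univ absv)"
  unfolding valuated_matroid_def
proof (intro conjI ballI)
  let ?E = "dual :: ('k ^ 'n \<Rightarrow> 'k) set"
  have absm: "\<And>x y. absv (x * y) = absv x * absv y" and absz: "\<And>x. absv x = 0 \<longleftrightarrow> x = 0"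
    and absp: "\<And>x. absv x \<ge> 0"
    using assms by (auto simp: nonarch_absolute_value_def)
  show "w_univ absv A \<noteq> -\<infinity>" for A :: "('k ^ 'n \<Rightarrow> 'k) set"
    by (simp add: w_univ_def Let_def val_def neg_log_def)
  show "\<exists>A\<in>nsets ?E CARD('n). w_univ absv A \<noteq> \<infinity>"
  proof
    let ?h = "\<lambda>(j::'n) (x::'k^'n). x $ j"
    have inj: "inj ?h"
    proof (rule injI)
      fix i j assume "?h i = ?h j"
      then have "(axis i 1 :: 'k^'n) $ i = axis i 1 $ j" by (rule fun_cong)
      then show "i = j" by (auto simp: axis_def split: if_splits)
    qed
    have "Vector_Spaces.linear (*s) (*) (?h j)" for j
      by unfold_locales (auto simp: algebra_simps)
    with inj show "range ?h \<in> nsets ?E CARD('n)"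
      by (auto simp: nsets_def dual_def card_image)
    have "(\<chi> i j. ?h j (axis i 1)) = (mat 1 :: 'k^'n^'n)"
      by (auto simp: vec_eq_iff mat_def axis_def)
    then show "w_univ absv (range ?h) \<noteq> \<infinity>"
      using w_univ_eq[OF assms inj_on_imp_bij_betw[OF inj]]
      by (simp add: val_def neg_log_def nonarch_absv_simps[OF assms])
  qed
  fix A B a assume A: "A \<in> nsets ?E CARD('n)" and B: "B \<in> nsets ?E CARD('n)" and a: "a \<in> A - B"
  let ?t = "\<lambda>b. w_univ absv (insert b (A - {a})) + w_univ absv (insert a (B - {b}))"
  show "Min (?t ` (B - A)) \<le> w_univ absv A + w_univ absv B"
  proof (cases "w_univ absv A = \<infinity> \<or> w_univ absv B = \<infinity>")
    case True
    then show ?thesis by auto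
  next
    case False
    obtain g :: "'n \<Rightarrow> 'k ^ 'n \<Rightarrow> 'k" where g: "bij_betw g UNIV A"
      using finite_same_card_bij[of "UNIV :: 'n set" A] A by (auto simp: nsets_def)
    obtain h :: "'n \<Rightarrow> 'k ^ 'n \<Rightarrow> 'k" where h: "bij_betw h UNIV B"
      using finite_same_card_bij[of "UNIV :: 'n set" B] B by (auto simp: nsets_def)
    define D where "D = (\<lambda>g :: 'n \<Rightarrow> 'k ^ 'n \<Rightarrow> 'k. det (\<chi> i j. g j (axis i 1)))"
    have wA: "w_univ absv A = val absv (D g)" and wB: "w_univ absv B = val absv (D h)"
      unfolding D_def using w_univ_eq assms g h by blast+
    have nz: "D g \<noteq> 0" "D h \<noteq> 0"
      using False wA wB absz[of 0] by (auto simp: val_def neg_log_def)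
    obtain k where k: "g k = a" using g a by (metis DiffD1 bij_betw_def imageE)
    have col: "(\<chi> i j. if j = l then c (axis i 1) else h' j (axis i 1))
        = (\<chi> i j. (h'(l := c)) j (axis i 1))" for l c and h' :: "'n \<Rightarrow> 'k ^ 'n \<Rightarrow> 'k"
      by (auto simp: vec_eq_iff)
    define x where "x = (\<lambda>j. D (h(j := a)) / D h)"
    have "(\<chi> i j. h j (axis i 1)) *v (\<chi> j. x j) = (\<chi> i. a (axis i 1))"
    proof (subst cramer)
      show "det (\<chi> i j. h j (axis i 1)) \<noteq> 0" using nz by (simp add: D_def)
      show "(\<chi> j. x j) = (\<chi> l. det (\<chi> i j. if j = l then (\<chi> i. a (axis i 1)) $ i
                     else (\<chi> i j. h j (axis i 1)) $ i $ j) / det (\<chi> i j. h j (axis i 1)))"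
        by (simp only: x_def D_def vec_lambda_beta col[of _ a h])
    qed
    then have xa: "a (axis i 1) = (\<Sum>l\<in>UNIV. x l * h l (axis i 1))" for i
      by (auto simp: vec_eq_iff matrix_vector_mult_def mult.commute)
    have "D g = det (\<chi> i j. if j = k then (\<Sum>l\<in>UNIV. x l * h l (axis i 1))
                            else (\<chi> i j. g j (axis i 1)) $ i $ j)"
      unfolding D_def by (rule arg_cong[where f = det]) (auto simp: vec_eq_iff k xa[symmetric])
    also have "\<dots> = (\<Sum>l\<in>UNIV. x l * D (g(k := h l)))"
      unfolding det_linear_column_sum D_def
      by (simp only: vec_lambda_beta col[of k _ g])
    finally obtain l where "absv (D g) \<le> absv (x l * D (g(k := h l)))"
      using nonarch_sum_le[OF assms, of UNIV "\<lambda>l. x l * D (g(k := h l))"] by auto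
    then have "absv (D g * D h) \<le> absv (x l * D (g(k := h l)) * D h)"
      by (simp add: absm mult_right_mono absp)
    also have "x l * D (g(k := h l)) * D h = D (h(l := a)) * D (g(k := h l))"
      using nz by (simp add: x_def)
    finally have le: "absv (D g * D h) \<le> absv (D (h(l := a)) * D (g(k := h l)))" .
    have abspos: "0 < absv y" if "y \<noteq> 0" for y
      using absp[of y] absz[of y] that by linarith
    have "0 < absv (D (h(l := a)) * D (g(k := h l)))"
      using le abspos[of "D g * D h"] nz by auto
    then have nz2: "D (h(l := a)) \<noteq> 0" "D (g(k := h l)) \<noteq> 0"
      using absz[of 0] by auto
    have hlB: "h l \<in> B" using h by (auto simp: bij_betw_def)
    have hlA: "h l \<notin> A"
    proof
      assume "h l \<in> A"
      then obtain m where m: "g m = h l" using g by (metis bij_betw_def imageE)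
      have "m \<noteq> k" using m k a hlB by auto
      then have "D (g(k := h l)) = 0"
        unfolding D_def using det_repeated_column[of m k "\<lambda>j i. (g(k := h l)) j (axis i 1)"] m
        by simp
      with nz2 show False by simp
    qed
    have "bij_betw (g(k := h l)) UNIV (insert (h l) (A - {a}))"
      by (rule bij_betw_replace[OF g k hlA])
    then have w1: "w_univ absv (insert (h l) (A - {a})) = val absv (D (g(k := h l)))"
      unfolding D_def by (rule w_univ_eq[OF assms])
    have "bij_betw (h(l := a)) UNIV (insert a (B - {h l}))"
      using bij_betw_replace[OF h refl] a by blast
    then have w2: "w_univ absv (insert a (B - {h l})) = val absv (D (h(l := a)))"
      unfolding D_def by (rule w_univ_eq[OF assms])
    have "?t (h l) \<le> w_univ absv A + w_univ absv B"
    proof -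
      have P: "absv (D g) > 0" "absv (D h) > 0" "absv (D (h(l := a))) > 0" "absv (D (g(k := h l))) > 0"
        using nz nz2 by (simp_all add: abspos)
      have "ln (absv (D g) * absv (D h)) \<le> ln (absv (D (h(l := a))) * absv (D (g(k := h l))))"
        using le P by (simp add: absm)
      then show ?thesis
        using P unfolding w1 w2 wA wB by (simp add: val_def neg_log_def ln_mult)
    qed
    moreover have "finite (B - A)" using B by (auto simp: nsets_def)
    ultimately show ?thesis
      using hlA hlB by (meson DiffI Min_le finite_imageI image_eqI order_trans)
  qed
qed

end

theory Submission
  imports Defs
begin

text \<open>
  Under \<open>N = exp (- u)\<close> a seminorm \<open>N\<close> on the space of linear forms corresponds to a vector \<open>u\<close> with
  entries in the extended line, and homothety to translation by a real constant.  Both halves of the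
  theorem are read off from this dictionary.

  \<^emph>\<open>Bijectivity.\<close>  A set \<open>\<tau>\<close> of \<open>r + 2\<close> linear forms satisfies a linear relation
  \<open>\<Sum>e\<in>\<tau>. x e * e = 0\<close> whose coefficients are, up to sign, the determinants of the sets
  \<open>\<tau> - {e}\<close> (Cramer's rule, \<open>circuit_relation\<close>).  The tropical condition at \<open>\<tau>\<close> thus says that the
  maximum of the numbers \<open>N (x e * e)\<close> is attained twice.  For a seminorm this is the ultrametric
  inequality: no summand of a vanishing sum is strictly larger than all the others
  (\<open>tropical_vector_of_seminorm\<close>).  Conversely, the axioms of a seminorm are tropical conditions at
  particular sets \<open>\<tau>\<close>: a basis together with \<open>0\<close> gives \<open>N 0 = 0\<close>; a basis containing \<open>f\<close>,
  together with \<open>c * f\<close>, gives homogeneity; and a basis containing \<open>f\<close> and \<open>g\<close>, together with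
  \<open>f + g\<close>, gives the ultrametric inequality (\<open>seminorm_of_tropical_vector\<close>).

  \<^emph>\<open>Topology.\<close>  That the map is continuous is checked on the projections to the finite sets \<open>E'\<close> of
  the inverse limit, where it is a coordinatewise logarithm followed by a quotient map.  For the
  inverse map the classes are normalised: a nonzero seminorm cannot vanish on a basis \<open>D\<close>, so each
  homothety class contains a unique \<open>N\<close> with \<open>\<Sum>d\<in>D. N d = 1\<close>.  The value of this representative at
  \<open>f\<close> is a function of the restriction of \<open>u\<close> to the finite set \<open>insert f D\<close>, and it is continuous
  in it (\<open>continuous_map_class_share_Trop\<close>).  This gives a continuous section into the space of
  seminorms, hence a continuous inverse.
\<close>

section \<open>The logarithmic chart of the extended line\<close>

text \<open>
  The inverse of \<open>neg_log\<close> on \<open>{-\<infinity><..}\<close>.  The value at \<open>\<infinity>\<close> is given separately because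
  \<open>real_of_ereal \<infinity> = 0\<close>.
\<close>

definition exp_neg :: "ereal \<Rightarrow> real" where
  "exp_neg x = (if x = \<infinity> then 0 else exp (- real_of_ereal x))"

lemma neg_log_gt_minf [simp]: "-\<infinity> < neg_log t"
  by (simp add: neg_log_def)

lemma neg_log_neq_minf [simp]: "neg_log t \<noteq> -\<infinity>"
  by (simp add: neg_log_def)

lemma neg_log_0 [simp]: "neg_log 0 = \<infinity>"
  by (simp add: neg_log_def)

lemma neg_log_eq_infty_iff [simp]: "neg_log t = \<infinity> \<longleftrightarrow> t = 0"
  by (simp add: neg_log_def)

lemma exp_neg_nonneg [simp]: "0 \<le> exp_neg x"
  by (simp add: exp_neg_def)

lemma exp_neg_eq_0_iff [simp]: "exp_neg x = 0 \<longleftrightarrow> x = \<infinity>"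
  by (simp add: exp_neg_def)

lemma exp_neg_neg_log [simp]: "0 \<le> t \<Longrightarrow> exp_neg (neg_log t) = t"
  by (auto simp: exp_neg_def neg_log_def)

lemma neg_log_exp_neg [simp]: "-\<infinity> < x \<Longrightarrow> neg_log (exp_neg x) = x"
  by (cases x) (auto simp: exp_neg_def neg_log_def)

lemma neg_log_le_iff:
  assumes "0 \<le> s" "0 \<le> t"
  shows "neg_log s \<le> neg_log t \<longleftrightarrow> t \<le> s"
  using assms by (auto simp: neg_log_def)

lemma neg_log_mult:
  assumes "0 \<le> s" "0 \<le> t"
  shows "neg_log (s * t) = neg_log s + neg_log t"
  using assms by (auto simp: neg_log_def ln_mult)

lemma exp_neg_add:
  assumes "-\<infinity> < x" "-\<infinity> < y"
  shows "exp_neg (x + y) = exp_neg x * exp_neg y"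
  using assms by (cases x; cases y) (auto simp: exp_neg_def exp_diff exp_minus field_simps)

lemma exp_neg_add_real:
  assumes "-\<infinity> < x"
  shows "exp_neg (x + ereal c) = exp (- c) * exp_neg x"
  using exp_neg_add[OF assms, of "ereal c"] by (simp add: exp_neg_def)

lemma exp_neg_le_iff:
  assumes "-\<infinity> < x" "-\<infinity> < y"
  shows "exp_neg x \<le> exp_neg y \<longleftrightarrow> y \<le> x"
  using neg_log_le_iff[of "exp_neg y" "exp_neg x"] assms by simp

lemma range_neg_log: "neg_log ` {0..} = {-\<infinity><..}"
proof
  show "{-\<infinity><..} \<subseteq> neg_log ` {0..}"
  proof
    fix x :: ereal assume "x \<in> {-\<infinity><..}"
    then show "x \<in> neg_log ` {0..}"
      by (intro image_eqI[of _ _ "exp_neg x"]) auto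
  qed
qed auto

text \<open>
  A decreasing map onto an open set is continuous, because preimages of rays are rays; this also
  covers the point \<open>0\<close>, where the value is \<open>\<infinity>\<close>.
\<close>

lemma continuous_on_neg_log: "continuous_on {0..} neg_log"
proof -
  have "(\<lambda>t. - neg_log t) ` {0..} = {..<\<infinity>}"
  proof -
    have "(\<lambda>t. - neg_log t) ` {0..} = uminus ` {-\<infinity><..}"
      by (simp add: image_image range_neg_log[symmetric])
    also have "\<dots> = {..<\<infinity>}"
    proof (intro equalityI subsetI)
      fix x :: ereal assume "x \<in> {..<\<infinity>}"
      then show "x \<in> uminus ` {-\<infinity><..}"
        by (intro image_eqI[of _ _ "- x"]) (cases x; simp)+
    next
      fix x :: ereal assume "x \<in> uminus ` {-\<infinity><..}"
      then show "x \<in> {..<\<infinity>}" by (cases x) auto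
    qed
    finally show ?thesis .
  qed
  then have "continuous_on {0..} (\<lambda>t. - neg_log t)"
    by (intro continuous_onI_mono) (auto simp: neg_log_le_iff)
  then show ?thesis
    by (auto simp: continuous_on_def ereal_Lim_uminus[of neg_log])
qed

text \<open>
  The image \<open>{0..}\<close> is not open in \<open>\<real>\<close>, so the criterion for monotone maps does not apply; the two
  kinds of rays are pulled back by hand along the inverse \<open>neg_log\<close>.
\<close>

lemma continuous_on_exp_neg: "continuous_on {-\<infinity><..} exp_neg"
  unfolding continuous_on_def
proof
  fix x0 :: ereal assume x0: "x0 \<in> {-\<infinity><..}"
  have *: "eventually (\<lambda>x. x \<in> {-\<infinity><..}) (at x0 within {-\<infinity><..})"
    by (simp add: eventually_at_filter)
  have lt: "exp_neg x < exp_neg y \<longleftrightarrow> y < x" if "-\<infinity> < x" "-\<infinity> < y" for x y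
    using exp_neg_le_iff[OF that(2,1)] by auto
  show "(exp_neg \<longlongrightarrow> exp_neg x0) (at x0 within {-\<infinity><..})"
  proof (rule order_tendstoI)
    fix a assume a: "a < exp_neg x0"
    show "eventually (\<lambda>x. a < exp_neg x) (at x0 within {-\<infinity><..})"
    proof (cases "a < 0")
      case True
      then show ?thesis by (simp add: less_le_trans[OF _ exp_neg_nonneg])
    next
      case False
      then have "a = exp_neg (neg_log a)" by simp
      with a have "x0 < neg_log a" using x0 lt[of "neg_log a" x0] by simp
      then have "eventually (\<lambda>x. x < neg_log a) (at x0 within {-\<infinity><..})"
        using order_tendstoD(2)[OF tendsto_ident_at] by blast
      with * show ?thesis
      proof eventually_elim
        case (elim x)
        then show ?case using lt[of "neg_log a" x] False by simp
      qed
    qed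
  next
    fix a assume a: "exp_neg x0 < a"
    then have "0 < a" using exp_neg_nonneg[of x0] by linarith
    then have "neg_log a < x0" using a x0 lt[of x0 "neg_log a"] by simp
    then have "eventually (\<lambda>x. neg_log a < x) (at x0 within {-\<infinity><..})"
      using order_tendstoD(1)[OF tendsto_ident_at] by blast
    with * show "eventually (\<lambda>x. exp_neg x < a) (at x0 within {-\<infinity><..})"
    proof eventually_elim
      case (elim x)
      then show ?case using lt[of x "neg_log a"] \<open>0 < a\<close> by simp
    qed
  qed
qed


section \<open>Linear forms, determinants and Cramer's rule\<close>

text \<open>
  The determinant whose valuation is \<open>w_univ\<close>: the columns are the coordinate vectors of the forms
  \<open>h j\<close>.
\<close>

definition coord_det :: "('n \<Rightarrow> 'k::field ^ 'n \<Rightarrow> 'k) \<Rightarrow> 'k" where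
  "coord_det h = det (\<chi> i j. h j (axis i 1))"

lemma dual_iff:
  "f \<in> dual \<longleftrightarrow> (\<forall>x y. f (x + y) = f x + f y) \<and> (\<forall>c x. f (c *s x) = c * f x)"
  unfolding dual_def mem_Collect_eq Vector_Spaces.linear_iff
  using vec.vector_space_axioms vector_space_over_itself.vector_space_axioms by auto

lemma dual_add: "f \<in> dual \<Longrightarrow> g \<in> dual \<Longrightarrow> (\<lambda>x. f x + g x) \<in> dual"
  by (auto simp: dual_iff algebra_simps)

lemma dual_scale: "f \<in> dual \<Longrightarrow> (\<lambda>x. c * f x) \<in> dual"
  by (auto simp: dual_iff algebra_simps)

lemma dual_zero: "(\<lambda>x. 0) \<in> dual"
  by (auto simp: dual_iff)

lemma dual_sum:
  "(\<And>e. e \<in> S \<Longrightarrow> h e \<in> dual) \<Longrightarrow> (\<lambda>x. \<Sum>e\<in>S. h e x) \<in> dual"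
  by (induction S rule: infinite_finite_induct) (auto intro: dual_zero dual_add)

lemma coordinate_in_dual: "(\<lambda>x. x $ i) \<in> dual"
  by (auto simp: dual_iff)

lemma dual_expansion:
  assumes "f \<in> dual"
  shows "f x = (\<Sum>i\<in>UNIV. f (axis i 1) * x $ i)"
proof -
  have s: "f (\<Sum>i\<in>S. x $ i *s axis i 1) = (\<Sum>i\<in>S. x $ i * f (axis i 1))" for S
  proof (induction S rule: infinite_finite_induct)
    case empty
    have "f (0 *s 0) = 0 * f 0" using assms unfolding dual_iff by blast
    then show ?case by simp
  qed (use assms in \<open>simp_all add: dual_iff\<close>)
  show ?thesis using s[of UNIV] by (simp add: basis_expansion mult.commute)
qed

text \<open>
  Cramer's rule without division: it computes the coordinates \<open>y\<close> of \<open>f\<close> from the determinants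
  that enter \<open>w_univ\<close>.
\<close>

lemma coord_det_replace:
  assumes "f = (\<lambda>v. \<Sum>l\<in>UNIV. y l * h l v)"
  shows "coord_det (h(k := f)) = y k * coord_det h"
proof -
  let ?A = "\<chi> i j. h j (axis i 1)" and ?y = "\<chi> l. y l"
  have "(\<chi> i j. (h(k := f)) j (axis i 1)) = (\<chi> i j. if j = k then (?A *v ?y) $ i else ?A $ i $ j)"
    by (auto simp: vec_eq_iff matrix_vector_mult_def assms mult.commute)
  then show ?thesis
    using cramer_lemma[of k ?A ?y] by (simp add: coord_det_def)
qed

lemma coordinates_exist:
  assumes f: "f \<in> dual" and h: "\<And>l. h l \<in> dual" and nz: "coord_det h \<noteq> 0"
  obtains y where "f = (\<lambda>v. \<Sum>l\<in>UNIV. y l * h l v)"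
proof -
  let ?A = "\<chi> i j. h j (axis i 1)"
  obtain y where "?A *v y = (\<chi> i. f (axis i 1))"
    using cramer[of ?A _ "\<chi> i. f (axis i 1)"] nz unfolding coord_det_def by blast
  then have y: "f (axis i 1) = (\<Sum>l\<in>UNIV. y $ l * h l (axis i 1))" for i
    by (auto simp: vec_eq_iff matrix_vector_mult_def mult.commute)
  have g: "(\<lambda>v. \<Sum>l\<in>UNIV. y $ l * h l v) \<in> dual"
    using h by (intro dual_sum dual_scale)
  have "f = (\<lambda>v. \<Sum>l\<in>UNIV. y $ l * h l v)"
  proof
    fix v
    show "f v = (\<Sum>l\<in>UNIV. y $ l * h l v)"
      unfolding dual_expansion[OF f, of v] dual_expansion[OF g, of v] y ..
  qed
  then show ?thesis by (rule that)
qed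

lemma coord_det_coordinates: "coord_det (\<lambda>j (x :: 'k::field ^ 'n). x $ j) = 1"
proof -
  have "(\<chi> i j. axis i 1 $ j) = (mat 1 :: 'k ^ 'n ^ 'n)"
    by (auto simp: vec_eq_iff mat_def axis_def)
  then show ?thesis by (simp only: coord_det_def det_I)
qed

text \<open>
  If the \<open>i\<close>-th coordinate of \<open>f\<close> is nonzero, then \<open>f\<close> can replace the \<open>i\<close>-th coordinate form.
\<close>

lemma extend_to_basis:
  assumes f: "f \<in> dual" and nz: "f \<noteq> (\<lambda>_. 0)"
  obtains h i where "h i = f" "\<And>l. h l \<in> dual" "coord_det h \<noteq> 0"
proof -
  have "\<exists>i. f (axis i 1) \<noteq> 0"
  proof (rule ccontr)
    assume "\<nexists>i. f (axis i 1) \<noteq> 0"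
    then have "f x = 0" for x using dual_expansion[OF f, of x] by simp
    with nz show False by auto
  qed
  then obtain i where i: "f (axis i 1) \<noteq> 0" ..
  let ?h = "(\<lambda>j x. x $ j)(i := f)"
  have "coord_det ?h = f (axis i 1)"
    using coord_det_replace[of f "\<lambda>l. f (axis l 1)" "\<lambda>j x. x $ j" i, OF ext, OF dual_expansion[OF f]]
    by (simp only: coord_det_coordinates mult_1_right)
  with i show ?thesis
    by (intro that[of ?h i]) (auto simp: f coordinate_in_dual)
qed

lemma coord_det_nonzero_inj:
  assumes "coord_det h \<noteq> 0"
  shows "inj h"
proof (rule injI, rule ccontr)
  fix i j assume "h i = h j" "i \<noteq> j"
  then have "coord_det h = 0"
    unfolding coord_det_def using det_repeated_column[of i j "\<lambda>j i. h j (axis i 1)"] by simp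
  with assms show False by simp
qed

text \<open>
  For a basis \<open>h\<close> and one further form \<open>f\<close>, the values of \<open>w_univ\<close> that enter the tropical condition
  at \<open>insert f (range h)\<close> are the valuations of the coefficients of the relation
  \<open>f = (\<Sum>l. y l * h l)\<close>, all shifted by the valuation of \<open>coord_det h\<close>.
\<close>

lemma w_univ_circuit:
  assumes abs: "nonarch_absolute_value absv"
    and h: "coord_det h \<noteq> 0" and f: "f = (\<lambda>v. \<Sum>l\<in>UNIV. y l * h l v)" "f \<notin> range h"
  shows "w_univ absv (insert f (range h) - {f}) = val absv (coord_det h)"
    and "w_univ absv (insert f (range h) - {h l}) = val absv (y l * coord_det h)"
proof -
  have b: "bij_betw h UNIV (range h)"
    using coord_det_nonzero_inj[OF h] by (rule inj_on_imp_bij_betw)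
  have "insert f (range h) - {f} = range h" using f(2) by auto
  then show "w_univ absv (insert f (range h) - {f}) = val absv (coord_det h)"
    using w_univ_eq[OF abs b] by (simp add: coord_det_def)
  have "bij_betw (h(l := f)) UNIV (insert f (range h - {h l}))"
    by (rule bij_betw_replace[OF b refl f(2)])
  moreover have "insert f (range h) - {h l} = insert f (range h - {h l})" using f(2) by auto
  ultimately have "w_univ absv (insert f (range h) - {h l}) = val absv (coord_det (h(l := f)))"
    using w_univ_eq[OF abs, of "h(l := f)"] by (simp only: coord_det_def)
  then show "w_univ absv (insert f (range h) - {h l}) = val absv (y l * coord_det h)"
    by (simp add: coord_det_replace[OF f(1)])
qed

text \<open>
  Unless all the determinants vanish, some \<open>\<tau> - {f}\<close> is a basis, and expanding \<open>f\<close> in it and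
  multiplying by the determinant of that basis gives the relation.  If all of them vanish, the trivial
  relation has the required valuations.
\<close>

lemma circuit_relation:
  fixes absv :: "'k::field \<Rightarrow> real" and \<tau> :: "('k ^ 'n \<Rightarrow> 'k) set"
  assumes abs: "nonarch_absolute_value absv"
    and \<tau>: "\<tau> \<in> nsets dual (CARD('n) + 1)"
  obtains x where "\<And>e. e \<in> \<tau> \<Longrightarrow> w_univ absv (\<tau> - {e}) = val absv (x e)"
    and "\<And>v. (\<Sum>e\<in>\<tau>. x e * e v) = 0"
proof (cases "\<forall>e\<in>\<tau>. w_univ absv (\<tau> - {e}) = \<infinity>")
  case True
  have "absv 0 = 0" using abs by (simp add: nonarch_absolute_value_def)
  with True show ?thesis by (intro that[of "\<lambda>_. 0"]) (auto simp: val_def)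
next
  case False
  then obtain f where f: "f \<in> \<tau>" "w_univ absv (\<tau> - {f}) \<noteq> \<infinity>" by blast
  have t: "\<tau> \<subseteq> dual" "finite \<tau>" "card \<tau> = CARD('n) + 1" using \<tau> by (auto simp: nsets_def)
  obtain h :: "'n \<Rightarrow> 'k ^ 'n \<Rightarrow> 'k" where h: "bij_betw h UNIV (\<tau> - {f})"
    using finite_same_card_bij[of "UNIV :: 'n set" "\<tau> - {f}"] t f(1) by auto
  have r: "range h = \<tau> - {f}" and inj: "inj h" using h by (auto simp: bij_betw_def)
  have "w_univ absv (\<tau> - {f}) = val absv (coord_det h)"
    using w_univ_eq[OF abs h] by (simp add: coord_det_def)
  with f(2) abs have nz: "coord_det h \<noteq> 0"
    by (auto simp: val_def nonarch_absolute_value_def)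
  have hd: "h l \<in> dual" for l using r t by auto
  have fd: "f \<in> dual" using f t by auto
  obtain y where y: "f = (\<lambda>v. \<Sum>l\<in>UNIV. y l * h l v)"
    using coordinates_exist[OF fd hd nz] .
  have fh: "f \<notin> range h" using r by auto
  have \<tau>_eq: "\<tau> = insert f (range h)" using r f by auto
  define x where "x = (\<lambda>e. if e = f then - coord_det h else y (inv h e) * coord_det h)"
  have "w_univ absv (\<tau> - {e}) = val absv (x e)" if e: "e \<in> \<tau>" for e
  proof (cases "e = f")
    case True
    then show ?thesis
      using w_univ_circuit(1)[OF abs nz y fh] nonarch_absv_simps(2)[OF abs]
      by (simp add: \<tau>_eq x_def val_def)
  next
    case False
    then obtain l where "e = h l" using e \<tau>_eq by auto
    then show ?thesis
      using w_univ_circuit(2)[OF abs nz y fh, of l] False inj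
      by (simp add: \<tau>_eq x_def)
  qed
  moreover have "(\<Sum>e\<in>\<tau>. x e * e v) = 0" for v
  proof -
    have "(\<Sum>e\<in>\<tau>. x e * e v) = x f * f v + (\<Sum>e\<in>range h. x e * e v)"
      unfolding \<tau>_eq using fh by (subst sum.insert) auto
    also have "(\<Sum>e\<in>range h. x e * e v) = (\<Sum>l\<in>UNIV. x (h l) * h l v)"
      using inj by (simp add: sum.reindex)
    also have "\<dots> = (\<Sum>l\<in>UNIV. coord_det h * (y l * h l v))"
      using fh inj by (intro sum.cong) (auto simp: x_def)
    also have "\<dots> = coord_det h * f v"
      by (subst y) (simp add: sum_distrib_left)
    finally show ?thesis by (simp add: x_def)
  qed
  ultimately show ?thesis by (rule that)
qed

section \<open>Points of a tropical linear space\<close>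

text \<open>
  That a minimum over \<open>\<tau>\<close> is attained twice means that no term is strictly smaller than all the
  others; see \<open>min_attained_twice_iff\<close>.  In this form the condition is an ultrametric inequality for
  each term and no longer mentions \<open>Min\<close>.
\<close>

definition tropical_vector :: "'e set \<Rightarrow> nat \<Rightarrow> ('e set \<Rightarrow> ereal) \<Rightarrow> ('e \<Rightarrow> ereal) \<Rightarrow> bool" where
  "tropical_vector E \<rho> v u \<longleftrightarrow>
     (\<forall>\<tau>\<in>nsets E (\<rho> + 1). \<forall>e0\<in>\<tau>. \<exists>e\<in>\<tau> - {e0}. v (\<tau> - {e}) + u e \<le> v (\<tau> - {e0}) + u e0)"

lemma min_attained_twice_iff:
  fixes t :: "'e \<Rightarrow> 'a::linorder"
  assumes "finite \<tau>" "\<tau> \<noteq> {}"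
  shows "(\<exists>e1\<in>\<tau>. \<exists>e2\<in>\<tau>. e1 \<noteq> e2 \<and> t e1 = Min (t ` \<tau>) \<and> t e2 = Min (t ` \<tau>))
     \<longleftrightarrow> (\<forall>e0\<in>\<tau>. \<exists>e\<in>\<tau> - {e0}. t e \<le> t e0)" (is "?L \<longleftrightarrow> ?R")
proof
  assume ?L
  then obtain e1 e2 where e: "e1 \<in> \<tau>" "e2 \<in> \<tau>" "e1 \<noteq> e2" "t e1 = Min (t ` \<tau>)" "t e2 = Min (t ` \<tau>)"
    by blast
  have "t e1 \<le> t e0" "t e2 \<le> t e0" if "e0 \<in> \<tau>" for e0
    unfolding e(4,5) using assms that by auto
  then show ?R using e(1-3) by (metis Diff_iff singletonD)
next
  assume R: ?R
  have "Min (t ` \<tau>) \<in> t ` \<tau>" using assms by (intro Min_in) auto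
  then obtain e1 where e1: "e1 \<in> \<tau>" "Min (t ` \<tau>) = t e1" by blast
  then obtain e2 where e2: "e2 \<in> \<tau>" "e2 \<noteq> e1" "t e2 \<le> t e1" using R by blast
  have "Min (t ` \<tau>) \<le> t e2" using assms e2 by auto
  then show ?L using e1 e2 by (metis order_antisym)
qed

lemma Trop_eq:
  "Trop E \<rho> v = {TP_class E u | u. u \<in> TP_vectors E \<and> tropical_vector E \<rho> v u}"
proof -
  have "finite \<tau> \<and> \<tau> \<noteq> {}" if "\<tau> \<in> nsets E (\<rho> + 1)" for \<tau>
    using that by (auto simp: nsets_def)
  then show ?thesis
    unfolding Trop_def Let_def tropical_vector_def
    by (simp add: min_attained_twice_iff cong: conj_cong ball_cong)
qed

lemma TP_rel_iff:
  "(u, w) \<in> TP_rel E \<longleftrightarrow> u \<in> TP_vectors E \<and> w \<in> TP_vectors E \<and> (\<exists>c::real. \<forall>e\<in>E. w e = u e + ereal c)"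
  by (simp add: TP_rel_def)

lemma tropical_vector_TP_rel:
  assumes "(u, w) \<in> TP_rel E" "tropical_vector E \<rho> v u"
  shows "tropical_vector E \<rho> v w"
  unfolding tropical_vector_def
proof (intro ballI)
  fix \<tau> e0 assume t: "\<tau> \<in> nsets E (\<rho> + 1)" "e0 \<in> \<tau>"
  obtain c :: real where c: "\<And>e. e \<in> E \<Longrightarrow> w e = u e + ereal c"
    using assms(1) by (auto simp: TP_rel_iff)
  obtain e where e: "e \<in> \<tau> - {e0}" "v (\<tau> - {e}) + u e \<le> v (\<tau> - {e0}) + u e0"
    using assms(2) t unfolding tropical_vector_def by blast
  have "w e = u e + ereal c" "w e0 = u e0 + ereal c"
    using c e t by (auto simp: nsets_def)
  then have "v (\<tau> - {e}) + w e \<le> v (\<tau> - {e0}) + w e0"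
    using add_right_mono[OF e(2), of "ereal c"] by (simp add: add.assoc)
  with e show "\<exists>e\<in>\<tau> - {e0}. v (\<tau> - {e}) + w e \<le> v (\<tau> - {e0}) + w e0" by blast
qed


section \<open>Seminorms and tropical vectors\<close>

lemma nonzero_seminormsD:
  assumes "N \<in> nonzero_seminorms absv"
  shows "N \<in> extensional dual"
    and "f \<in> dual \<Longrightarrow> 0 \<le> N f"
    and "f \<in> dual \<Longrightarrow> N (\<lambda>x. c * f x) = absv c * N f"
    and "f \<in> dual \<Longrightarrow> g \<in> dual \<Longrightarrow> N (\<lambda>x. f x + g x) \<le> max (N f) (N g)"
    and "\<exists>f\<in>dual. N f \<noteq> 0"
  using assms by (auto simp: nonzero_seminorms_def)

lemma seminorm_sum_le:
  assumes N: "N \<in> nonzero_seminorms absv" and "finite S" "S \<noteq> {}" "\<And>e. e \<in> S \<Longrightarrow> h e \<in> dual"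
  shows "\<exists>e\<in>S. N (\<lambda>v. \<Sum>e\<in>S. h e v) \<le> N (h e)"
  using assms(2-4)
proof (induction rule: finite_ne_induct)
  case (insert x F)
  then obtain e where e: "e \<in> F" "N (\<lambda>v. \<Sum>e\<in>F. h e v) \<le> N (h e)" by auto
  have "N (\<lambda>v. h x v + (\<Sum>e\<in>F. h e v)) \<le> max (N (h x)) (N (\<lambda>v. \<Sum>e\<in>F. h e v))"
    using insert.prems by (intro nonzero_seminormsD(4)[OF N] dual_sum) auto
  with e insert.hyps show ?case by (auto simp: max_def split: if_splits intro: order_trans)
qed simp

text \<open>
  In the relation \<open>\<Sum>e\<in>\<tau>. x e * e = 0\<close> each term is minus the sum of the others, so by the ultrametric
  inequality one of the others is at least as large.
\<close>

lemma tropical_vector_of_seminorm: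
  fixes absv :: "'k::field \<Rightarrow> real" and N :: "('k ^ 'n \<Rightarrow> 'k) \<Rightarrow> real"
  assumes abs: "nonarch_absolute_value absv" and N: "N \<in> nonzero_seminorms absv"
  shows "tropical_vector dual CARD('n) (w_univ absv) (\<lambda>f\<in>dual. neg_log (N f))"
  unfolding tropical_vector_def
proof (intro ballI)
  fix \<tau> :: "('k ^ 'n \<Rightarrow> 'k) set" and e0
  assume \<tau>: "\<tau> \<in> nsets dual (CARD('n) + 1)" and e0: "e0 \<in> \<tau>"
  have t: "\<tau> \<subseteq> dual" "finite \<tau>" "card \<tau> = CARD('n) + 1" using \<tau> by (auto simp: nsets_def)
  have pos: "0 \<le> absv c" for c using abs by (simp add: nonarch_absolute_value_def)
  obtain x where x: "\<And>e. e \<in> \<tau> \<Longrightarrow> w_univ absv (\<tau> - {e}) = val absv (x e)"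
    and rel: "\<And>v. (\<Sum>e\<in>\<tau>. x e * e v) = 0"
    using circuit_relation[OF abs \<tau>] by blast
  have e0_eq: "(\<lambda>v. x e0 * e0 v) = (\<lambda>v. \<Sum>e\<in>\<tau> - {e0}. - x e * e v)"
  proof
    fix v
    have "x e0 * e0 v + (\<Sum>e\<in>\<tau> - {e0}. x e * e v) = 0"
      using rel[of v] sum.remove[OF t(2) e0, of "\<lambda>e. x e * e v"] by simp
    then show "x e0 * e0 v = (\<Sum>e\<in>\<tau> - {e0}. - x e * e v)"
      by (simp add: sum_negf eq_neg_iff_add_eq_0)
  qed
  have "card (\<tau> - {e0}) \<noteq> 0" using t e0 by simp
  then have "\<tau> - {e0} \<noteq> {}" by (metis card.empty)
  moreover have "(\<lambda>v. - x e * e v) \<in> dual" if "e \<in> \<tau> - {e0}" for e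
    using that t by (intro dual_scale) auto
  ultimately have "\<exists>e\<in>\<tau> - {e0}. N (\<lambda>v. x e0 * e0 v) \<le> N (\<lambda>v. - x e * e v)"
    unfolding e0_eq using t(2) by (intro seminorm_sum_le[OF N]) auto
  then obtain e where e: "e \<in> \<tau> - {e0}" "N (\<lambda>v. x e0 * e0 v) \<le> N (\<lambda>v. - x e * e v)" ..
  have d: "e \<in> dual" "e0 \<in> dual" "e \<in> \<tau>" using e e0 t by auto
  have le: "absv (x e0) * N e0 \<le> absv (x e) * N e"
    using e(2) nonzero_seminormsD(3)[OF N d(1), of "- x e"] nonzero_seminormsD(3)[OF N d(2), of "x e0"]
      nonarch_absv_simps(2)[OF abs] by simp
  have "w_univ absv (\<tau> - {e'}) + neg_log (N e') = neg_log (absv (x e') * N e')" if "e' \<in> \<tau>" for e'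
    using x[OF that] that t nonzero_seminormsD(2)[OF N, of e'] pos
    by (simp add: val_def neg_log_mult subsetD)
  then have "w_univ absv (\<tau> - {e}) + neg_log (N e) \<le> w_univ absv (\<tau> - {e0}) + neg_log (N e0)"
    using d(3) e0 le pos nonzero_seminormsD(2)[OF N d(1)] nonzero_seminormsD(2)[OF N d(2)]
    by (simp add: neg_log_le_iff)
  then show "\<exists>e\<in>\<tau> - {e0}. w_univ absv (\<tau> - {e}) + (\<lambda>f\<in>dual. neg_log (N f)) e
      \<le> w_univ absv (\<tau> - {e0}) + (\<lambda>f\<in>dual. neg_log (N f)) e0"
    using e(1) d by (intro bexI[of _ e]) auto
qed

text \<open>
  Used in the contrapositive: a form whose coordinates are not those of a unit vector lies outside
  the basis, so that the two together form a set \<open>\<tau>\<close> of the right cardinality.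
\<close>

lemma coordinates_of_basis_element:
  assumes h: "coord_det h \<noteq> 0" and f: "f = (\<lambda>v. \<Sum>l\<in>UNIV. y l * h l v)" "f = h j"
  shows "y j = 1" and "k \<noteq> j \<Longrightarrow> y k = 0"
proof -
  have "coord_det (h(j := f)) = coord_det h" using f(2) by simp
  then show "y j = 1" using coord_det_replace[OF f(1), of j] h by simp
  assume "k \<noteq> j"
  then have "(h(k := f)) k = (h(k := f)) j" using f(2) by simp
  then have "coord_det (h(k := f)) = 0" using coord_det_nonzero_inj \<open>k \<noteq> j\<close> by (metis injD)
  then show "y k = 0" using coord_det_replace[OF f(1), of k] h by simp
qed

text \<open>
  The tropical condition at \<open>insert f (range h)\<close> in multiplicative form: none of the values at \<open>f\<close> and at
  the summands \<open>y l * h l\<close> of \<open>f\<close> is strictly larger than all the others.  The common factor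
  \<open>absv (coord_det h)\<close> of the terms cancels.
\<close>

lemma tropical_vector_circuit:
  fixes absv :: "'k::field \<Rightarrow> real" and u :: "('k ^ 'n \<Rightarrow> 'k) \<Rightarrow> ereal"
  assumes abs: "nonarch_absolute_value absv" and u: "u \<in> TP_vectors dual"
    and trop: "tropical_vector dual CARD('n) (w_univ absv) u"
    and h: "\<And>l. h l \<in> dual" "coord_det h \<noteq> 0"
    and f: "f \<in> dual" "f = (\<lambda>v. \<Sum>l\<in>UNIV. y l * h l v)" "f \<notin> range h"
  shows "\<exists>l. exp_neg (u f) \<le> absv (y l) * exp_neg (u (h l))"
    and "absv (y k) * exp_neg (u (h k)) \<le> exp_neg (u f) \<or>
      (\<exists>l. l \<noteq> k \<and> absv (y k) * exp_neg (u (h k)) \<le> absv (y l) * exp_neg (u (h l)))"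
proof -
  let ?\<tau> = "insert f (range h)"
  have pos: "0 \<le> absv c" for c using abs by (simp add: nonarch_absolute_value_def)
  have mult: "absv (c * d) = absv c * absv d" for c d using abs by (simp add: nonarch_absolute_value_def)
  have "0 < absv (coord_det h)"
    using h(2) pos[of "coord_det h"] abs by (auto simp: nonarch_absolute_value_def less_le)
  then have cancel: "a * absv (coord_det h) \<le> b * absv (coord_det h) \<longleftrightarrow> a \<le> b" for a b by simp
  have inj: "inj h" using h(2) by (rule coord_det_nonzero_inj)
  then have \<tau>: "?\<tau> \<in> nsets dual (CARD('n) + 1)"
    using h(1) f(1,3) by (auto simp: nsets_def card_image)
  have gt: "-\<infinity> < u e" if "e \<in> dual" for e using u that by (simp add: TP_vectors_iff)
  have term_exp: "exp_neg (val absv c + u e) = absv c * exp_neg (u e)" if "e \<in> dual" for c e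
    using gt[OF that] pos by (simp add: val_def exp_neg_add)
  have wf: "exp_neg (w_univ absv (?\<tau> - {f}) + u f) = exp_neg (u f) * absv (coord_det h)"
    unfolding w_univ_circuit(1)[OF abs h(2) f(2,3)] using term_exp[OF f(1)] by simp
  have wh: "exp_neg (w_univ absv (?\<tau> - {h l}) + u (h l))
      = (absv (y l) * exp_neg (u (h l))) * absv (coord_det h)" for l
    unfolding w_univ_circuit(2)[OF abs h(2) f(2,3)] using term_exp[OF h(1)] by (simp add: mult)
  have gt': "-\<infinity> < w_univ absv A + u e" if "e \<in> dual" for A :: "('k ^ 'n \<Rightarrow> 'k) set" and e
  proof -
    have "-\<infinity> < w_univ absv A" by (simp add: w_univ_def Let_def val_def)
    then show ?thesis using gt[OF that] by simp
  qed
  have ex: "\<exists>e\<in>?\<tau> - {e0}. exp_neg (w_univ absv (?\<tau> - {e0}) + u e0) \<le> exp_neg (w_univ absv (?\<tau> - {e}) + u e)"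
    if e0: "e0 \<in> ?\<tau>" for e0
  proof -
    obtain e where e: "e \<in> ?\<tau> - {e0}" "w_univ absv (?\<tau> - {e}) + u e \<le> w_univ absv (?\<tau> - {e0}) + u e0"
      using trop[unfolded tropical_vector_def, rule_format, OF \<tau> e0] by (rule bexE)
    have "e \<in> dual" "e0 \<in> dual" using e(1) e0 h(1) f(1) by auto
    then have "exp_neg (w_univ absv (?\<tau> - {e0}) + u e0) \<le> exp_neg (w_univ absv (?\<tau> - {e}) + u e)"
      using e(2) by (simp only: exp_neg_le_iff gt')
    then show ?thesis using e(1) by (rule bexI)
  qed
  obtain l where "exp_neg (w_univ absv (?\<tau> - {f}) + u f) \<le> exp_neg (w_univ absv (?\<tau> - {h l}) + u (h l))"
    using ex[of f] f(3) by auto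
  then show "\<exists>l. exp_neg (u f) \<le> absv (y l) * exp_neg (u (h l))"
    unfolding wf wh cancel ..
  obtain e where e: "e \<in> ?\<tau> - {h k}"
      "exp_neg (w_univ absv (?\<tau> - {h k}) + u (h k)) \<le> exp_neg (w_univ absv (?\<tau> - {e}) + u e)"
    using ex[of "h k", OF insertI2[OF rangeI]] by (rule bexE)
  show "absv (y k) * exp_neg (u (h k)) \<le> exp_neg (u f) \<or>
      (\<exists>l. l \<noteq> k \<and> absv (y k) * exp_neg (u (h k)) \<le> absv (y l) * exp_neg (u (h l)))"
  proof (cases "e = f")
    case True
    then show ?thesis using e(2) unfolding True wf wh cancel by simp
  next
    case False
    then obtain l where l: "e = h l" "l \<noteq> k" using e(1) by auto
    then show ?thesis using e(2) unfolding l(1) wh cancel by blast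
  qed
qed

text \<open>
  Each axiom is a tropical condition for a suitable basis \<open>h\<close> and form.  At most two of its
  coordinates are nonzero, so at most three terms of the condition remain.
\<close>

lemma seminorm_of_tropical_vector:
  fixes absv :: "'k::field \<Rightarrow> real" and u :: "('k ^ 'n \<Rightarrow> 'k) \<Rightarrow> ereal"
  assumes abs: "nonarch_absolute_value absv" and u: "u \<in> TP_vectors dual"
    and trop: "tropical_vector dual CARD('n) (w_univ absv) u"
  shows "(\<lambda>f\<in>dual. exp_neg (u f)) \<in> nonzero_seminorms absv"
proof -
  define p where "p = (\<lambda>f. exp_neg (u f))"
  have p0: "0 \<le> p f" for f by (simp add: p_def)
  have pos: "0 \<le> absv c" for c using abs by (simp add: nonarch_absolute_value_def)
  have a0: "absv 0 = 0" using abs by (simp add: nonarch_absolute_value_def)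
  have a1: "absv 1 = 1" by (rule nonarch_absv_simps[OF abs])
  have circ1: "\<exists>l. p f \<le> absv (y l) * p (h l)"
    if "\<And>l. h l \<in> dual" "coord_det h \<noteq> 0" "f \<in> dual" "f = (\<lambda>v. \<Sum>l\<in>UNIV. y l * h l v)" "f \<notin> range h"
    for f h y
    using tropical_vector_circuit(1)[OF abs u trop that] by (simp add: p_def)
  have circ2: "absv (y k) * p (h k) \<le> p f \<or> (\<exists>l. l \<noteq> k \<and> absv (y k) * p (h k) \<le> absv (y l) * p (h l))"
    if "\<And>l. h l \<in> dual" "coord_det h \<noteq> 0" "f \<in> dual" "f = (\<lambda>v. \<Sum>l\<in>UNIV. y l * h l v)" "f \<notin> range h"
    for f h y k
    using tropical_vector_circuit(2)[OF abs u trop that] by (simp add: p_def)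
  have zero: "p (\<lambda>_. 0) = 0"
  proof -
    let ?h = "\<lambda>j (x :: 'k ^ 'n). x $ j"
    have "\<exists>l. p (\<lambda>_. 0) \<le> absv 0 * p (?h l)"
    proof (rule circ1)
      show "(\<lambda>_. 0) \<notin> range ?h"
        using coordinates_of_basis_element(1)[of ?h "\<lambda>_. 0" "\<lambda>_. 0"]
        by (auto simp: coord_det_coordinates)
    qed (auto simp: coordinate_in_dual coord_det_coordinates dual_zero)
    then show ?thesis using p0[of "\<lambda>_. 0"] by (simp add: a0)
  qed
  \<comment> \<open>For \<open>c = 1\<close> the form \<open>c * f\<close> is itself an element of the basis, hence the separate treatment.\<close>
  have homog: "p (\<lambda>x. c * f x) = absv c * p f" if f: "f \<in> dual" for c f
  proof (cases "f = (\<lambda>_. 0) \<or> c = 0 \<or> c = 1")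
    case True
    then show ?thesis by (auto simp: zero a0 a1)
  next
    case False
    then obtain h i where h: "h i = f" "\<And>l. h l \<in> dual" "coord_det h \<noteq> 0"
      using extend_to_basis[OF f] by blast
    let ?y = "\<lambda>l. if l = i then c else 0"
    have y: "(\<lambda>x. c * f x) = (\<lambda>v. \<Sum>l\<in>UNIV. ?y l * h l v)"
      by (simp add: if_distrib[of "\<lambda>c. c * _"] h(1) cong: if_cong)
    have nr: "(\<lambda>x. c * f x) \<notin> range h"
    proof
      assume "(\<lambda>x. c * f x) \<in> range h"
      then obtain j where "(\<lambda>x. c * f x) = h j" by blast
      from coordinates_of_basis_element(1)[OF h(3) y this] False show False
        by (auto split: if_splits)
    qed
    have "p (\<lambda>x. c * f x) \<le> absv c * p f"
      using circ1[OF h(2,3) dual_scale[OF f] y nr] pos[of c] p0[of f]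
      by (auto simp: a0 h(1) split: if_splits intro: order_trans)
    moreover have "absv c * p f \<le> p (\<lambda>x. c * f x)"
      using circ2[OF h(2,3) dual_scale[OF f] y nr, of i] p0[of "\<lambda>x. c * f x"]
      by (auto simp: a0 h(1) intro: order_trans)
    ultimately show ?thesis by simp
  qed
  have ultra: "p (\<lambda>x. f x + g x) \<le> max (p f) (p g)" if f: "f \<in> dual" and g: "g \<in> dual" for f g
  proof (cases "f = (\<lambda>_. 0)")
    case True
    then show ?thesis by simp
  next
    case False
    then obtain h i where h: "h i = f" "\<And>l. h l \<in> dual" "coord_det h \<noteq> 0"
      using extend_to_basis[OF f] by blast
    obtain y where y: "g = (\<lambda>v. \<Sum>l\<in>UNIV. y l * h l v)"
      using coordinates_exist[OF g h(2,3)] .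
    \<comment> \<open>If \<open>g\<close> is a multiple of \<open>f\<close>, homogeneity reduces the claim to the ultrametric inequality in the
       field; otherwise \<open>g\<close> can replace a basis element other than \<open>f\<close>.\<close>
    show ?thesis
    proof (cases "\<forall>j. j \<noteq> i \<longrightarrow> y j = 0")
      case True
      have "(\<Sum>l\<in>UNIV. y l * h l v) = y i * f v" for v
      proof -
        have "(\<Sum>l\<in>UNIV. y l * h l v) = (\<Sum>l\<in>UNIV. if l = i then y i * f v else 0)"
          using True h(1) by (intro sum.cong) auto
        then show ?thesis by simp
      qed
      then have g_eq: "g = (\<lambda>v. y i * f v)" using y by simp
      have "p (\<lambda>x. f x + g x) = absv (1 + y i) * p f"
        using homog[OF f, of "1 + y i"] by (simp add: g_eq algebra_simps)
      also have "\<dots> \<le> max 1 (absv (y i)) * p f"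
      proof (rule mult_right_mono[OF _ p0])
        have "absv (1 + y i) \<le> max (absv 1) (absv (y i))"
          using abs unfolding nonarch_absolute_value_def by blast
        then show "absv (1 + y i) \<le> max 1 (absv (y i))" by (simp add: a1)
      qed
      also have "\<dots> = max (p f) (p g)"
        using homog[OF f, of "y i"] p0[of f] by (simp add: g_eq max_mult_distrib_right)
      finally show ?thesis .
    next
      case False
      then obtain j where j: "j \<noteq> i" "y j \<noteq> 0" by blast
      define h' where "h' = h(j := g)"
      have h'ij: "h' i = f" "h' j = g" using h(1) j(1) by (auto simp: h'_def)
      have h'd: "h' l \<in> dual" for l using h(2) g by (simp add: h'_def)
      have nz: "coord_det h' \<noteq> 0"
        unfolding h'_def coord_det_replace[OF y] using j(2) h(3) by simp
      let ?y = "\<lambda>l. if l = i \<or> l = j then 1 else 0"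
      have y': "(\<lambda>x. f x + g x) = (\<lambda>v. \<Sum>l\<in>UNIV. ?y l * h' l v)"
      proof
        fix v
        have "(\<Sum>l\<in>UNIV. ?y l * h' l v) = (\<Sum>l\<in>UNIV. (if l = i then f v else 0) + (if l = j then g v else 0))"
          using j(1) h'ij by (intro sum.cong) auto
        then show "f v + g v = (\<Sum>l\<in>UNIV. ?y l * h' l v)" by (simp add: sum.distrib)
      qed
      have "(\<lambda>x. f x + g x) \<notin> range h'"
      proof
        assume "(\<lambda>x. f x + g x) \<in> range h'"
        then obtain m where m: "(\<lambda>x. f x + g x) = h' m" by blast
        show False
          using coordinates_of_basis_element(2)[OF nz y' m, of i]
            coordinates_of_basis_element(2)[OF nz y' m, of j] j(1) by auto
      qed
      from circ1[OF h'd nz dual_add[OF f g] y' this]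
      obtain l where "p (\<lambda>x. f x + g x) \<le> absv (?y l) * p (h' l)" by blast
      then show ?thesis
        using h'ij p0[of f] by (auto simp: a0 a1 max_def split: if_splits)
    qed
  qed
  obtain f where "f \<in> dual" "u f \<noteq> \<infinity>" using u unfolding TP_vectors_iff by blast
  then have "\<exists>f\<in>dual. p f \<noteq> 0" by (auto simp: p_def)
  then show ?thesis
    unfolding nonzero_seminorms_def using p0 homog ultra
    by (auto simp: p_def[symmetric] dual_scale dual_add)
qed


section \<open>Continuous functions on tropical linear spaces\<close>

text \<open>
  The value at \<open>e\<close> of the representative of the class of \<open>u\<close> for which the values of \<open>exp_neg\<close> on \<open>D\<close>
  add up to \<open>1\<close>.  A sum is used rather than a maximum since its continuity is immediate.
\<close>

definition share :: "'e set \<Rightarrow> 'e \<Rightarrow> ('e \<Rightarrow> ereal) \<Rightarrow> real" where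
  "share D e u = exp_neg (u e) / (\<Sum>d\<in>D. exp_neg (u d))"

definition class_share :: "'e set \<Rightarrow> 'e \<Rightarrow> ('e \<Rightarrow> ereal) set \<Rightarrow> real" where
  "class_share D e C = share D e (SOME u. u \<in> C)"

lemma share_TP_rel:
  assumes "(u, w) \<in> TP_rel E" "D \<subseteq> E" "e \<in> E"
  shows "share D e w = share D e u"
proof -
  obtain c :: real where c: "\<And>d. d \<in> E \<Longrightarrow> w d = u d + ereal c" and u: "u \<in> TP_vectors E"
    using assms(1) by (auto simp: TP_rel_iff)
  have "exp_neg (w d) = exp (- c) * exp_neg (u d)" if "d \<in> E" for d
    using u that by (simp add: c exp_neg_add_real TP_vectors_iff)
  then have "exp_neg (w e) = exp (- c) * exp_neg (u e)"
    and "(\<Sum>d\<in>D. exp_neg (w d)) = exp (- c) * (\<Sum>d\<in>D. exp_neg (u d))"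
    using assms(2,3) by (auto simp: sum_distrib_left intro!: sum.cong)
  then show ?thesis by (simp add: share_def)
qed

lemma TP_class_self: "u \<in> TP_vectors E \<Longrightarrow> u \<in> TP_class E u"
  unfolding TP_class_def by (rule equiv_class_self[OF equiv_TP_rel])

lemma TP_class_eqI: "(u, w) \<in> TP_rel E \<Longrightarrow> TP_class E u = TP_class E w"
  unfolding TP_class_def by (rule equiv_class_eq[OF equiv_TP_rel])

lemma some_TP_class:
  assumes "u \<in> TP_vectors E"
  shows "(u, SOME w. w \<in> TP_class E u) \<in> TP_rel E"
  using someI[of "\<lambda>w. w \<in> TP_class E u", OF TP_class_self[OF assms]] by (simp add: TP_class_def)

lemma class_share_TP_class:
  assumes "u \<in> TP_vectors E" "D \<subseteq> E" "e \<in> E"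
  shows "class_share D e (TP_class E u) = share D e u"
  unfolding class_share_def by (rule share_TP_rel[OF some_TP_class[OF assms(1)] assms(2,3)])

lemma quotient_map_TP_class:
  "quotient_map (subtopology (product_topology (\<lambda>_. euclidean) E) (TP_vectors E)) (TP_topology E) (TP_class E)"
  using quotient_map_quotient_topology[of "subtopology (product_topology (\<lambda>_. euclidean) E) (TP_vectors E)" "TP_rel E"]
    equiv_TP_rel[of E]
  by (simp only: topspace_TP_vectors TP_topology_def TP_class_def[abs_def])

text \<open>
  On \<open>TP_topology E\<close> the normalisation has to be over all of \<open>E\<close>: over a smaller set the denominator can
  vanish.
\<close>

lemma continuous_map_class_share:
  assumes "finite E" "e \<in> E"
  shows "continuous_map (TP_topology E) euclideanreal (class_share E e)"
proof (rule continuous_compose_quotient_map[OF quotient_map_TP_class])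
  let ?X = "subtopology (product_topology (\<lambda>_. euclidean :: ereal topology) E) (TP_vectors E)"
  have coord: "continuous_map ?X euclideanreal (\<lambda>u. exp_neg (u d))" if "d \<in> E" for d
  proof -
    have "continuous_map ?X (top_of_set {-\<infinity><..}) (\<lambda>u. u d)"
      using that unfolding continuous_map_in_subtopology topspace_TP_vectors
      by (auto simp: TP_vectors_iff
          intro: continuous_map_from_subtopology continuous_map_product_projection)
    moreover have "continuous_map (top_of_set {-\<infinity><..}) euclideanreal exp_neg"
      using continuous_on_exp_neg by simp
    ultimately have "continuous_map ?X euclideanreal (exp_neg \<circ> (\<lambda>u. u d))"
      by (rule continuous_map_compose)
    then show ?thesis by (simp only: o_def)
  qed
  have "(\<Sum>d\<in>E. exp_neg (u d)) \<noteq> 0" if "u \<in> TP_vectors E" for u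
    using that assms(1) by (auto simp: TP_vectors_iff sum_nonneg_eq_0_iff)
  then have "continuous_map ?X euclideanreal (share E e)"
    unfolding share_def
    by (intro continuous_map_real_divide continuous_map_sum coord assms)
      (simp_all add: topspace_TP_vectors del: topspace_subtopology)
  then show "continuous_map ?X euclideanreal (class_share E e \<circ> TP_class E)"
    by (rule continuous_map_eq) (simp add: topspace_TP_vectors class_share_TP_class assms del: topspace_subtopology)
qed

text \<open>
  The point is that the restriction is not identically \<open>\<infinity>\<close>: a tropical vector has a finite entry in
  every basis.
\<close>

lemma restrict_Trop:
  assumes v: "\<forall>A\<in>nsets E \<rho>. v A \<noteq> -\<infinity>"
    and u: "u \<in> TP_vectors E" "tropical_vector E \<rho> v u" and E': "E' \<in> finite_restrictions E \<rho> v"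
  shows "restrict u E' \<in> TP_vectors E'"
    and "TP_proj E' (TP_class E u) = TP_class E' (restrict u E')"
proof -
  have "TP_class E u \<in> Trop E \<rho> v" using u by (auto simp: Trop_eq)
  then have "TP_proj E' (TP_class E u) \<in> TP_vectors E' // TP_rel E'"
    using TP_proj_Trop[OF v _ E'] Trop_subset by blast
  then have "TP_proj E' (TP_class E u) \<subseteq> TP_vectors E'"
    by (rule in_quotient_imp_subset[OF equiv_TP_rel])
  then show r: "restrict u E' \<in> TP_vectors E'"
    using TP_class_self[OF u(1)] by (auto simp: TP_proj_def)
  have "E' \<subseteq> E" using E' by (simp add: finite_restrictions_def)
  then show "TP_proj E' (TP_class E u) = TP_class E' (restrict u E')"
    using TP_proj_class u(1) r by blast
qed

lemma continuous_map_TP_proj: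
  assumes "E' \<in> finite_restrictions E \<rho> v"
  shows "continuous_map (Trop_topology E \<rho> v) (TP_topology E') (TP_proj E')"
proof -
  have "continuous_map (product_topology (\<lambda>E'. subtopology (TP_topology E') (Trop E' \<rho> v))
          (finite_restrictions E \<rho> v)) (TP_topology E') (\<lambda>x. x E')"
    using continuous_map_product_projection[OF assms, of "\<lambda>E'. subtopology (TP_topology E') (Trop E' \<rho> v)"]
    unfolding continuous_map_in_subtopology by (rule conjunct1)
  from continuous_map_pullback[OF this]
  have "continuous_map (Trop_topology E \<rho> v) (TP_topology E')
      ((\<lambda>x. x E') \<circ> (\<lambda>C. \<lambda>E'\<in>finite_restrictions E \<rho> v. TP_proj E' C))"
    unfolding Trop_topology_def .
  then show ?thesis
    using assms by (auto elim!: continuous_map_eq)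
qed

text \<open>
  On the tropical linear space the denominator over a set \<open>D\<close> containing a basis never vanishes.  With
  \<open>E' = insert e D\<close>, the share of \<open>e\<close> in \<open>D\<close> is the share of \<open>e\<close> in \<open>E'\<close> divided by the total share of
  \<open>D\<close> in \<open>E'\<close>, and shares in \<open>E'\<close> are continuous on the whole of \<open>TP_topology E'\<close>.
\<close>

lemma continuous_map_class_share_Trop:
  assumes v: "\<forall>A\<in>nsets E \<rho>. v A \<noteq> -\<infinity>"
    and D: "D \<in> finite_restrictions E \<rho> v" and e: "e \<in> E"
  shows "continuous_map (Trop_topology E \<rho> v) euclideanreal (class_share D e)"
proof -
  let ?E' = "insert e D"
  have E': "?E' \<in> finite_restrictions E \<rho> v"
    using D e by (auto simp: finite_restrictions_def nsets_def)
  then have fin: "finite ?E'" by (simp add: finite_restrictions_def)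
  have sub: "?E' \<subseteq> E" using E' by (simp add: finite_restrictions_def)
  let ?p = "\<lambda>d C. class_share ?E' d (TP_proj ?E' C)"
  have p: "?p d C = share ?E' d u"
    if "u \<in> TP_vectors E" "tropical_vector E \<rho> v u" "C = TP_class E u" "d \<in> ?E'" for d C u
  proof -
    have "?p d C = share ?E' d (restrict u ?E')"
      unfolding that(3) restrict_Trop(2)[OF v that(1,2) E']
      by (rule class_share_TP_class[OF restrict_Trop(1)[OF v that(1,2) E'] subset_refl that(4)])
    also have "\<dots> = share ?E' d u" using that(4) by (simp add: share_def)
    finally show ?thesis .
  qed
  have cont: "continuous_map (Trop_topology E \<rho> v) euclideanreal (?p d)" if "d \<in> ?E'" for d
    using continuous_map_compose[OF continuous_map_TP_proj[OF E'] continuous_map_class_share[OF fin that]]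
    by (simp add: o_def)
  have rep: "\<exists>u. u \<in> TP_vectors E \<and> tropical_vector E \<rho> v u \<and> C = TP_class E u"
    if "C \<in> topspace (Trop_topology E \<rho> v)" for C
    using that by (auto simp: topspace_Trop_topology[OF v] Trop_eq)
  have pos: "0 < (\<Sum>d\<in>D. exp_neg (u d))" if u: "u \<in> TP_vectors E" "tropical_vector E \<rho> v u" for u
  proof -
    obtain d where "d \<in> D" "u d \<noteq> \<infinity>"
      using restrict_Trop(1)[OF v u D] by (auto simp: TP_vectors_iff)
    then show ?thesis using D
      by (intro sum_pos2[of D d]) (auto simp: finite_restrictions_def less_le)
  qed
  have pos': "0 < (\<Sum>d\<in>?E'. exp_neg (u d))" if u: "u \<in> TP_vectors E" "tropical_vector E \<rho> v u" for u
    using pos[OF u] sum_mono2[OF fin, of D "\<lambda>d. exp_neg (u d)"] by fastforce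
  have "continuous_map (Trop_topology E \<rho> v) euclideanreal (\<lambda>C. ?p e C / (\<Sum>d\<in>D. ?p d C))"
  proof (intro continuous_map_real_divide continuous_map_sum cont)
    fix C assume "C \<in> topspace (Trop_topology E \<rho> v)"
    then obtain u where u: "u \<in> TP_vectors E" "tropical_vector E \<rho> v u" "C = TP_class E u"
      using rep by blast
    have "(\<Sum>d\<in>D. ?p d C) = (\<Sum>d\<in>D. exp_neg (u d)) / (\<Sum>d\<in>?E'. exp_neg (u d))"
      using p[OF u] by (simp add: share_def sum_divide_distrib)
    then show "(\<Sum>d\<in>D. ?p d C) \<noteq> 0" using pos[OF u(1,2)] pos'[OF u(1,2)] by simp
  qed (use fin in auto)
  then show ?thesis
  proof (rule continuous_map_eq)
    fix C assume "C \<in> topspace (Trop_topology E \<rho> v)"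
    then obtain u where u: "u \<in> TP_vectors E" "tropical_vector E \<rho> v u" "C = TP_class E u"
      using rep by blast
    have "?p e C / (\<Sum>d\<in>D. ?p d C) = share D e u"
      using p[OF u] pos'[OF u(1,2)] by (simp add: share_def sum_divide_distrib[symmetric])
    also have "\<dots> = class_share D e C"
      unfolding u(3) using class_share_TP_class[OF u(1)] sub by simp
    finally show "?p e C / (\<Sum>d\<in>D. ?p d C) = class_share D e C" .
  qed
qed


section \<open>The homeomorphism\<close>

lemma TP_vectors_of_seminorm:
  assumes "N \<in> nonzero_seminorms absv"
  shows "(\<lambda>f\<in>dual. neg_log (N f)) \<in> TP_vectors dual"
  using nonzero_seminormsD(5)[OF assms] by (auto simp: TP_vectors_iff)

lemma scale_seminorm:
  assumes N: "N \<in> nonzero_seminorms absv" and c: "c > 0"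
  shows "(N, \<lambda>f\<in>dual. c * N f) \<in> homothety absv"
proof -
  have "c * N (\<lambda>x. f x + g x) \<le> max (c * N f) (c * N g)" if "f \<in> dual" "g \<in> dual" for f g
    using mult_left_mono[OF nonzero_seminormsD(4)[OF N that], of c] c
    by (simp add: max_mult_distrib_left)
  moreover obtain f where "f \<in> dual" "N f \<noteq> 0" using nonzero_seminormsD(5)[OF N] by blast
  ultimately have "(\<lambda>f\<in>dual. c * N f) \<in> nonzero_seminorms absv"
    using c unfolding nonzero_seminorms_def
    by (auto simp: dual_add dual_scale nonzero_seminormsD(2,3)[OF N] intro!: bexI[of _ f])
  with N c show ?thesis by (auto simp: homothety_def)
qed

lemma homothety_imp_TP_rel:
  assumes "(N, N') \<in> homothety absv"
  shows "((\<lambda>f\<in>dual. neg_log (N f)), (\<lambda>f\<in>dual. neg_log (N' f))) \<in> TP_rel dual"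
proof -
  obtain c where c: "c > 0" "\<And>f. f \<in> dual \<Longrightarrow> N' f = c * N f"
    and N: "N \<in> nonzero_seminorms absv" "N' \<in> nonzero_seminorms absv"
    using assms by (auto simp: homothety_def)
  have "neg_log (N' f) = neg_log (N f) + ereal (- ln c)" if "f \<in> dual" for f
    using c nonzero_seminormsD(2)[OF N(1) that] that
    by (simp add: neg_log_mult add.commute) (simp add: neg_log_def)
  then show ?thesis
    using N by (auto simp: TP_rel_iff TP_vectors_of_seminorm intro!: exI[of _ "- ln c"])
qed

lemma TP_rel_imp_homothety:
  assumes r: "(u, w) \<in> TP_rel dual" and s: "(\<lambda>f\<in>dual. exp_neg (u f)) \<in> nonzero_seminorms absv"
  shows "((\<lambda>f\<in>dual. exp_neg (u f)), (\<lambda>f\<in>dual. exp_neg (w f))) \<in> homothety absv"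
proof -
  obtain c :: real where c: "\<And>f. f \<in> dual \<Longrightarrow> w f = u f + ereal c" and u: "u \<in> TP_vectors dual"
    using r by (auto simp: TP_rel_iff)
  have "exp_neg (w f) = exp (- c) * exp_neg (u f)" if "f \<in> dual" for f
    using u that by (simp add: c exp_neg_add_real TP_vectors_iff)
  then have "(\<lambda>f\<in>dual. exp_neg (w f)) = (\<lambda>f\<in>dual. exp (- c) * (\<lambda>f\<in>dual. exp_neg (u f)) f)"
    by (auto simp: restrict_def)
  then show ?thesis using scale_seminorm[OF s, of "exp (- c)"] by simp
qed

lemma quotient_map_homothety:
  "quotient_map (subtopology (powertop_real dual) (nonzero_seminorms absv)) (GI_topology absv)
     (\<lambda>N. homothety absv `` {N})"
  using quotient_map_quotient_topology[of "subtopology (powertop_real dual) (nonzero_seminorms absv)" "homothety absv"]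
    equiv_homothety[of absv]
  by (simp only: topspace_seminorms GI_topology_def)

lemma w_univ_neq_minf: "w_univ absv A \<noteq> -\<infinity>"
  by (simp add: w_univ_def Let_def val_def)

lemma Trop_of_seminorm:
  fixes absv :: "'k::field \<Rightarrow> real" and N :: "('k ^ 'n \<Rightarrow> 'k) \<Rightarrow> real"
  assumes "nonarch_absolute_value absv" "N \<in> nonzero_seminorms absv"
  shows "TP_class dual (\<lambda>f\<in>dual. neg_log (N f)) \<in> Trop dual CARD('n) (w_univ absv)"
  using TP_vectors_of_seminorm[OF assms(2)] tropical_vector_of_seminorm[OF assms]
  unfolding Trop_eq by blast

text \<open>
  By the universal property of the inverse limit it suffices to look at one finite \<open>E'\<close>, and there
  the map factors through the product topology on \<open>TP_vectors E'\<close>.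
\<close>

lemma continuous_map_Trop_of_seminorm:
  fixes absv :: "'k::field \<Rightarrow> real"
  assumes abs: "nonarch_absolute_value absv"
  shows "continuous_map (subtopology (powertop_real dual) (nonzero_seminorms absv))
    (Trop_topology (dual :: ('k ^ 'n \<Rightarrow> 'k) set) CARD('n) (w_univ absv))
    (\<lambda>N. TP_class dual (\<lambda>f\<in>dual. neg_log (N f)))"
proof -
  let ?E = "dual :: ('k ^ 'n \<Rightarrow> 'k) set" and ?v = "w_univ absv :: ('k ^ 'n \<Rightarrow> 'k) set \<Rightarrow> ereal"
  let ?X = "subtopology (powertop_real ?E) (nonzero_seminorms absv)"
  let ?F = "\<lambda>N. TP_class ?E (\<lambda>f\<in>?E. neg_log (N f))"
  have v: "\<forall>A\<in>nsets ?E CARD('n). ?v A \<noteq> -\<infinity>" by (simp add: w_univ_neq_minf)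
  have comp: "continuous_map ?X (subtopology (TP_topology E') (Trop E' CARD('n) ?v)) (\<lambda>N. TP_proj E' (?F N))"
    if E': "E' \<in> finite_restrictions ?E CARD('n) ?v" for E'
  proof (rule continuous_map_into_subtopology)
    show "(\<lambda>N. TP_proj E' (?F N)) \<in> topspace ?X \<rightarrow> Trop E' CARD('n) ?v"
      using TP_proj_Trop[OF v Trop_of_seminorm[OF abs] E'] by (simp add: topspace_seminorms del: topspace_subtopology)
    have sub: "E' \<subseteq> ?E" using E' by (simp add: finite_restrictions_def)
    let ?t = "\<lambda>N. \<lambda>f\<in>E'. neg_log (N f)"
    have t_eq: "restrict (\<lambda>f\<in>?E. neg_log (N f)) E' = ?t N" for N :: "('k ^ 'n \<Rightarrow> 'k) \<Rightarrow> real"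
      using sub by (auto simp: restrict_def fun_eq_iff)
    note rT = restrict_Trop[OF v TP_vectors_of_seminorm tropical_vector_of_seminorm[OF abs] E', unfolded t_eq]
    have coord: "continuous_map ?X euclidean (\<lambda>N. neg_log (N f))" if "f \<in> ?E" for f
    proof -
      have "continuous_map ?X (top_of_set {0..}) (\<lambda>N. N f)"
        using that unfolding continuous_map_in_subtopology topspace_seminorms
        by (auto simp: nonzero_seminormsD(2)
            intro: continuous_map_from_subtopology continuous_map_product_projection)
      moreover have "continuous_map (top_of_set {0..}) euclidean neg_log"
        using continuous_on_neg_log by simp
      ultimately have "continuous_map ?X euclidean (neg_log \<circ> (\<lambda>N. N f))"
        by (rule continuous_map_compose)
      then show ?thesis by (simp only: o_def)
    qed
    have "continuous_map ?X (product_topology (\<lambda>_. euclidean) E') ?t"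
      unfolding continuous_map_componentwise using coord sub by auto
    then have "continuous_map ?X (subtopology (product_topology (\<lambda>_. euclidean) E') (TP_vectors E')) ?t"
      using rT(1) by (auto simp: continuous_map_in_subtopology topspace_seminorms simp del: topspace_subtopology)
    from continuous_map_compose[OF this quotient_imp_continuous_map[OF quotient_map_TP_class]]
    have "continuous_map ?X (TP_topology E') (TP_class E' \<circ> ?t)" .
    then show "continuous_map ?X (TP_topology E') (\<lambda>N. TP_proj E' (?F N))"
      by (rule continuous_map_eq) (simp only: o_def topspace_seminorms rT(2))
  qed
  show ?thesis
    unfolding Trop_topology_def
  proof (rule continuous_map_pullback')
    show "continuous_map ?X (product_topology (\<lambda>E'. subtopology (TP_topology E') (Trop E' CARD('n) ?v))
        (finite_restrictions ?E CARD('n) ?v))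
        ((\<lambda>C. \<lambda>E'\<in>finite_restrictions ?E CARD('n) ?v. TP_proj E' C) \<circ> ?F)"
      unfolding continuous_map_componentwise using comp by (auto simp: o_def)
    show "topspace ?X \<subseteq> ?F -` Trop ?E CARD('n) ?v"
      using Trop_of_seminorm[OF abs] by (auto simp: topspace_seminorms simp del: topspace_subtopology)
  qed
qed

lemma seminorm_of_Trop:
  fixes absv :: "'k::field \<Rightarrow> real"
  assumes abs: "nonarch_absolute_value absv"
    and C: "C \<in> Trop (dual :: ('k ^ 'n \<Rightarrow> 'k) set) CARD('n) (w_univ absv)"
  shows "(SOME u. u \<in> C) \<in> TP_vectors dual" (is "?u \<in> _")
    and "tropical_vector dual CARD('n) (w_univ absv) (SOME u. u \<in> C)"
    and "TP_class dual (SOME u. u \<in> C) = C"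
    and "(\<lambda>f\<in>dual. exp_neg ((SOME u. u \<in> C) f)) \<in> nonzero_seminorms absv"
proof -
  obtain u where u: "u \<in> TP_vectors dual" "tropical_vector dual CARD('n) (w_univ absv) u" "C = TP_class dual u"
    using C unfolding Trop_eq by blast
  have r: "(u, ?u) \<in> TP_rel dual" unfolding u(3) by (rule some_TP_class[OF u(1)])
  then show 1: "?u \<in> TP_vectors dual" by (simp add: TP_rel_iff)
  show 2: "tropical_vector dual CARD('n) (w_univ absv) ?u"
    using tropical_vector_TP_rel[OF r u(2)] .
  show "TP_class dual ?u = C" using TP_class_eqI[OF r] u(3) by simp
  show "(\<lambda>f\<in>dual. exp_neg (?u f)) \<in> nonzero_seminorms absv"
    by (rule seminorm_of_tropical_vector[OF abs 1 2])
qed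

text \<open>
  The chosen representative \<open>SOME u. u \<in> C\<close> need not depend continuously on \<open>C\<close>, so within its homothety
  class it is replaced by the one normalised on a fixed basis \<open>D\<close>.
\<close>

lemma continuous_map_seminorm_of_Trop:
  fixes absv :: "'k::field \<Rightarrow> real"
  assumes abs: "nonarch_absolute_value absv"
  shows "continuous_map (Trop_topology (dual :: ('k ^ 'n \<Rightarrow> 'k) set) CARD('n) (w_univ absv))
     (GI_topology absv) (\<lambda>C. homothety absv `` {\<lambda>f\<in>dual. exp_neg ((SOME u. u \<in> C) f)})"
proof -
  let ?E = "dual :: ('k ^ 'n \<Rightarrow> 'k) set" and ?v = "w_univ absv :: ('k ^ 'n \<Rightarrow> 'k) set \<Rightarrow> ereal"
  let ?Y = "Trop_topology ?E CARD('n) ?v"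
  let ?X = "subtopology (powertop_real ?E) (nonzero_seminorms absv)"
  let ?N = "\<lambda>C. \<lambda>f\<in>?E. exp_neg ((SOME u. u \<in> C) f)"
  have v: "\<forall>A\<in>nsets ?E CARD('n). ?v A \<noteq> -\<infinity>" by (simp add: w_univ_neq_minf)
  obtain D where D: "D \<in> nsets ?E CARD('n)" "?v D \<noteq> \<infinity>"
    using valuated_matroid_w_univ[OF abs, where 'n = 'n] unfolding valuated_matroid_def by blast
  then have D': "D \<in> finite_restrictions ?E CARD('n) ?v"
    by (auto simp: finite_restrictions_def nsets_def intro!: exI[of _ D])
  let ?M = "\<lambda>C. \<lambda>f\<in>?E. class_share D f C"
  have hom: "(?N C, ?M C) \<in> homothety absv" if C: "C \<in> Trop ?E CARD('n) ?v" for C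
  proof -
    let ?u = "SOME u. u \<in> C"
    note u = seminorm_of_Trop[OF abs C]
    obtain d where "d \<in> D" "?u d \<noteq> \<infinity>"
      using restrict_Trop(1)[OF v u(1,2) D'] by (auto simp: TP_vectors_iff)
    then have pos: "0 < (\<Sum>d\<in>D. exp_neg (?u d))" using D(1)
      by (intro sum_pos2[of D d]) (auto simp: nsets_def less_le)
    have "?M C = (\<lambda>f\<in>?E. inverse (\<Sum>d\<in>D. exp_neg (?u d)) * ?N C f)"
      by (auto simp: restrict_def class_share_def share_def divide_inverse fun_eq_iff)
    then show ?thesis using scale_seminorm[OF u(4), of "inverse (\<Sum>d\<in>D. exp_neg (?u d))"] pos by simp
  qed
  have "continuous_map ?Y ?X ?M"
  proof (rule continuous_map_into_subtopology)
    show "continuous_map ?Y (powertop_real ?E) ?M"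
      unfolding continuous_map_componentwise
      using continuous_map_class_share_Trop[OF v D'] by auto
    show "?M \<in> topspace ?Y \<rightarrow> nonzero_seminorms absv"
      using hom by (auto simp: topspace_Trop_topology[OF v] homothety_def)
  qed
  from continuous_map_compose[OF this quotient_imp_continuous_map[OF quotient_map_homothety]]
  show ?thesis
    by (rule continuous_map_eq)
      (simp only: o_def topspace_Trop_topology[OF v] equiv_class_eq[OF equiv_homothety hom])
qed

theorem theorem0p3:
  fixes absv :: "'k::field \<Rightarrow> real" and r :: nat
  assumes "complete_nonarch_field absv"
    and "CARD('n::finite) = r + 1"
  shows "homeomorphic_map
           (GI_topology absv :: (('k ^ 'n \<Rightarrow> 'k) \<Rightarrow> real) set topology)
           (Trop_topology dual (r + 1) (w_univ absv))
           (\<lambda>x. let N = (SOME N. N \<in> x) in TP_class dual (\<lambda>f\<in>dual. neg_log (N f)))"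
proof -
  have abs: "nonarch_absolute_value absv"
    using assms(1) by (simp add: complete_nonarch_field_def)
  let ?E = "dual :: ('k ^ 'n \<Rightarrow> 'k) set" and ?v = "w_univ absv :: ('k ^ 'n \<Rightarrow> 'k) set \<Rightarrow> ereal"
  let ?X = "GI_topology absv :: (('k ^ 'n \<Rightarrow> 'k) \<Rightarrow> real) set topology"
  let ?Y = "Trop_topology ?E CARD('n) ?v"
  let ?T = "\<lambda>N :: ('k ^ 'n \<Rightarrow> 'k) \<Rightarrow> real. \<lambda>f\<in>?E. neg_log (N f)"
  let ?S = "\<lambda>u :: ('k ^ 'n \<Rightarrow> 'k) \<Rightarrow> ereal. \<lambda>f\<in>?E. exp_neg (u f)"
  let ?F = "\<lambda>x. TP_class ?E (?T (SOME N. N \<in> x))"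
  let ?G = "\<lambda>C. homothety absv `` {?S (SOME u. u \<in> C)}"
  have v: "\<forall>A\<in>nsets ?E CARD('n). ?v A \<noteq> -\<infinity>" by (simp add: w_univ_neq_minf)
  have ST: "?S (?T N) = N" if "N \<in> nonzero_seminorms absv" for N
    using nonzero_seminormsD(1,2)[OF that] by (intro extensionalityI[of _ dual]) auto
  have TS: "?T (?S u) = u" if "u \<in> TP_vectors ?E" for u
    using that by (intro extensionalityI[of _ dual]) (auto simp: TP_vectors_iff)
  have some: "(N, SOME N'. N' \<in> homothety absv `` {N}) \<in> homothety absv"
    if "N \<in> nonzero_seminorms absv" for N :: "('k ^ 'n \<Rightarrow> 'k) \<Rightarrow> real"
    using someI[of "\<lambda>N'. N' \<in> homothety absv `` {N}", OF equiv_class_self[OF equiv_homothety that]] by simp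
  have F: "?F (homothety absv `` {N}) = TP_class ?E (?T N)" if "N \<in> nonzero_seminorms absv" for N
    by (rule TP_class_eqI[OF homothety_imp_TP_rel[OF some[OF that]], symmetric])
  have "homeomorphic_maps ?X ?Y ?F ?G"
    unfolding homeomorphic_maps_def
  proof (intro conjI ballI)
    show "continuous_map ?X ?Y ?F"
    proof (rule continuous_compose_quotient_map[OF quotient_map_homothety])
      show "continuous_map (subtopology (powertop_real ?E) (nonzero_seminorms absv)) ?Y
          (?F \<circ> (\<lambda>N. homothety absv `` {N}))"
        by (rule continuous_map_eq[OF continuous_map_Trop_of_seminorm[OF abs]])
          (simp only: o_def topspace_seminorms F)
    qed
    show "continuous_map ?Y ?X ?G" by (rule continuous_map_seminorm_of_Trop[OF abs])
  next
    fix x assume "x \<in> topspace ?X"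
    then obtain N where N: "N \<in> nonzero_seminorms absv" "x = homothety absv `` {N}"
      by (auto simp: topspace_GI_topology elim: quotientE)
    let ?u = "SOME u. u \<in> TP_class ?E (?T N)"
    have "(?T N, ?u) \<in> TP_rel ?E" by (rule some_TP_class[OF TP_vectors_of_seminorm[OF N(1)]])
    then have "(?S (?T N), ?S ?u) \<in> homothety absv"
      by (rule TP_rel_imp_homothety) (simp only: ST N(1))
    then have "(N, ?S ?u) \<in> homothety absv" by (simp only: ST[OF N(1)])
    then show "?G (?F x) = x"
      unfolding N(2) F[OF N(1)] by (rule equiv_class_eq[OF equiv_homothety, symmetric])
  next
    fix C assume "C \<in> topspace ?Y"
    then have C: "C \<in> Trop ?E CARD('n) ?v" by (simp only: topspace_Trop_topology[OF v])
    note u = seminorm_of_Trop[OF abs C]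
    show "?F (?G C) = C"
      unfolding F[OF u(4)] TS[OF u(1)] by (rule u(3))
  qed
  then show ?thesis
    unfolding Let_def assms(2)[symmetric] by (rule homeomorphic_maps_imp_map)
qed

end
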